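(* The dual operads of $\mathcal{V}inb$, $G_4\text{-}\mathcal{A}ss$ and $G_5\text{-}\mathcal{A}ss$ are the quadratic operads whose corresponding algebras are the associative algebras satisfying, for all elements $a,b,c$, respectively: - for $\mathcal{V}inb^{!}$: $abc=bac$; - for $G_4\text{-}\mathcal{A}ss^{!}$: $abc=cba$; - for $G_5\text{-}\mathcal{A}ss^{!}$: $abc=bca=cab$.
   Context: $\mathbb{K}$ is a commutative field of characteristic zero and $\Sigma_n$ is the symmetric group of degree $n$. Let $E=\mathbb{K}[\Sigma_2]$ and let $\mathcal{F}(E)$ be the free operad generated by $E$ (one binary operation $x_1.x_2$ without symmetry). A basis of the 12-dimensional space $\mathcal{F}(E)(3)$ is given by the monomials $(x_i.x_j).x_k$ and $x_i.(x_j.x_k)$ with $\{i,j,k\}=\{1,2,3\}$. For a $\mathbb{K}[\Sigma_3]$-submodule $R\subset\mathcal{F}(E)(3)$, let $\mathcal{R}$ be the operadic ideal of $\mathcal{F}(E)$ generated by $R$; the binary quadratic operad generated by $E$ and $R$ is $\mathcal{F}(E)/\mathcal{R}$, whose algebras are vector spaces with a bilinear product satisfying the relations in $R$. The three operads are the quotients $\mathcal{F}(E)/\mathcal{R}$ where $R$ is the $\mathbb{K}[\Sigma_3]$-submodule generated by, respectively: - $\mathcal{V}inb$: $x_1.(x_2.x_3)-(x_1.x_2).x_3-x_2.(x_1.x_3)+(x_2.x_1).x_3$; - $G_4\text{-}\mathcal{A}ss$: $x_1.(x_2.x_3)-(x_1.x_2).x_3-x_3.(x_2.x_1)+(x_3.x_2).x_1$;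 - $G_5\text{-}\mathcal{A}ss$: $x_1.(x_2.x_3)-(x_1.x_2).x_3+x_2.(x_3.x_1)-(x_2.x_3).x_1+x_3.(x_1.x_2)-(x_3.x_1).x_2$. The dual operad of a binary quadratic operad $\mathcal{P}=\mathcal{P}(\mathbb{K},E,R)$ is $\mathcal{P}^!=\mathcal{P}(\mathbb{K},E^\vee,R^\perp)$ (Koszul dual operad in the sense of Ginzburg–Kapranov), where $E^\vee$ is the dual of $E$ tensored with the signature and $R^\perp$ is the orthogonal of $R$ in $\mathcal{F}(E^\vee)(3)=\mathcal{F}(E)(3)^\vee$. For $E=\mathbb{K}[\Sigma_2]$ this is $\mathcal{F}(E)/\mathcal{R}^\perp$, with $\mathcal{R}^\perp$ the ideal generated by the orthogonal $R^\perp$ of $R$ for the bilinear form on $\mathcal{F}(E)(3)$ for which distinct basis monomials are orthogonal and, with $s=\mathrm{sgn}\begin{pmatrix}1&2&3\\ i&j&k\end{pmatrix}$, $\langle x_i.(x_j.x_k),x_i.(x_j.x_k)\rangle=s$ and $\langle (x_i.x_j).x_k,(x_i.x_j).x_k\rangle=-s$. Algebras are not assumed unital. *)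

theory Defs
  imports Complex_Main "HOL-Library.Poly_Mapping" "HOL-Library.FuncSet" "HOL-Combinatorics.Permutations"
begin

section \<open>Symmetric \<open>\<K>\<close>-linear operads\<close>

text \<open>
  The structure maps of an operad in partial-composition form. The permutation group of
  \<open>{1..n}\<close> acts from the left (the usual right action composed with inversion), and
  \<open>opcomp P n m i f g\<close> is \<open>f \<circ>\<^sub>i g\<close> for \<open>f\<close> of arity \<open>n\<close> and \<open>g\<close> of arity \<open>m\<close>, of arity
  \<open>n + m - 1\<close>. The operad axioms are not part of the record: every operad below is an
  explicit construction.
\<close>

record ('k, 'p) operad =
  arity   :: "nat \<Rightarrow> 'p set"
  opzero  :: "nat \<Rightarrow> 'p"
  opadd   :: "nat \<Rightarrow> 'p \<Rightarrow> 'p \<Rightarrow> 'p"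
  opscale :: "nat \<Rightarrow> 'k \<Rightarrow> 'p \<Rightarrow> 'p"
  opact   :: "nat \<Rightarrow> (nat \<Rightarrow> nat) \<Rightarrow> 'p \<Rightarrow> 'p"
  opcomp  :: "nat \<Rightarrow> nat \<Rightarrow> nat \<Rightarrow> 'p \<Rightarrow> 'p \<Rightarrow> 'p"
  opunit  :: "'p"

definition submodule :: "('k, 'p) operad \<Rightarrow> nat \<Rightarrow> 'p set \<Rightarrow> bool"
  where "submodule P n M \<longleftrightarrow>
    M \<subseteq> arity P n \<and> opzero P n \<in> M \<and>
    (\<forall>f\<in>M. \<forall>g\<in>M. opadd P n f g \<in> M) \<and>
    (\<forall>c. \<forall>f\<in>M. opscale P n c f \<in> M) \<and>
    (\<forall>\<sigma>. \<sigma> permutes {1..n} \<longrightarrow> (\<forall>f\<in>M. opact P n \<sigma> f \<in> M))"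

definition operadic_ideal :: "('k, 'p) operad \<Rightarrow> (nat \<Rightarrow> 'p set) \<Rightarrow> bool"
  where "operadic_ideal P I \<longleftrightarrow>
    (\<forall>n. submodule P n (I n)) \<and>
    (\<forall>n m. \<forall>i\<in>{1..n}. \<forall>f\<in>arity P n. \<forall>g\<in>arity P m.
      f \<in> I n \<or> g \<in> I m \<longrightarrow> opcomp P n m i f g \<in> I (n + m - 1))"

definition ideal_generated :: "('k, 'p) operad \<Rightarrow> nat \<Rightarrow> 'p set \<Rightarrow> nat \<Rightarrow> 'p set"
  where "ideal_generated P k R n = \<Inter> {I n | I. operadic_ideal P I \<and> R \<subseteq> I k}"

definition ideal_class :: "('k, 'p) operad \<Rightarrow> (nat \<Rightarrow> 'p set) \<Rightarrow> nat \<Rightarrow> 'p \<Rightarrow> 'p set"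
  where "ideal_class P I n f = opadd P n f ` I n"

definition quotient_operad ::
    "('k, 'p) operad \<Rightarrow> (nat \<Rightarrow> 'p set) \<Rightarrow> ('k, 'p set) operad"
  where "quotient_operad P I = \<lparr>
    arity   = (\<lambda>n. ideal_class P I n ` arity P n),
    opzero  = (\<lambda>n. ideal_class P I n (opzero P n)),
    opadd   = (\<lambda>n A B. \<Union>f\<in>A. \<Union>g\<in>B. ideal_class P I n (opadd P n f g)),
    opscale = (\<lambda>n c A. \<Union>f\<in>A. ideal_class P I n (opscale P n c f)),
    opact   = (\<lambda>n \<sigma> A. \<Union>f\<in>A. ideal_class P I n (opact P n \<sigma> f)),
    opcomp  = (\<lambda>n m i A B.
                \<Union>f\<in>A. \<Union>g\<in>B. ideal_class P I (n + m - 1) (opcomp P n m i f g)),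
    opunit  = ideal_class P I 1 (opunit P) \<rparr>"

text \<open>
  Morphisms are families of maps, made extensional so that equality of morphisms is
  equality of functions.
\<close>

definition operad_hom :: "('k, 'p) operad \<Rightarrow> ('k, 'q) operad \<Rightarrow> (nat \<Rightarrow> 'p \<Rightarrow> 'q) set"
  where "operad_hom P Q = {\<phi>.
    (\<forall>n. \<phi> n \<in> arity P n \<rightarrow>\<^sub>E arity Q n) \<and>
    (\<forall>n. \<forall>f\<in>arity P n. \<forall>g\<in>arity P n.
      \<phi> n (opadd P n f g) = opadd Q n (\<phi> n f) (\<phi> n g)) \<and>
    (\<forall>n c. \<forall>f\<in>arity P n. \<phi> n (opscale P n c f) = opscale Q n c (\<phi> n f)) \<and>
    (\<forall>n \<sigma>. \<sigma> permutes {1..n} \<longrightarrow>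
      (\<forall>f\<in>arity P n. \<phi> n (opact P n \<sigma> f) = opact Q n \<sigma> (\<phi> n f))) \<and>
    (\<forall>n m. \<forall>i\<in>{1..n}. \<forall>f\<in>arity P n. \<forall>g\<in>arity P m.
      \<phi> (n + m - 1) (opcomp P n m i f g) = opcomp Q n m i (\<phi> n f) (\<phi> m g)) \<and>
    \<phi> 1 (opunit P) = opunit Q}"


section \<open>Algebras over an operad\<close>

text \<open>
  An \<open>n\<close>-ary operation on \<open>'v\<close> is a function of \<open>x :: nat \<Rightarrow> 'v\<close> that only depends on
  \<open>x 1, \<dots>, x n\<close>.
\<close>

definition multilinear :: "('k::field \<Rightarrow> 'v::ab_group_add \<Rightarrow> 'v) \<Rightarrow> nat \<Rightarrow> ((nat \<Rightarrow> 'v) \<Rightarrow> 'v) \<Rightarrow> bool"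
  where "multilinear scale n f \<longleftrightarrow>
    (\<forall>x y. (\<forall>i\<in>{1..n}. x i = y i) \<longrightarrow> f x = f y) \<and>
    (\<forall>i\<in>{1..n}. \<forall>x. Vector_Spaces.linear scale scale (\<lambda>v. f (x(i := v))))"

definition End_operad ::
    "('k::field \<Rightarrow> 'v::ab_group_add \<Rightarrow> 'v) \<Rightarrow> ('k, (nat \<Rightarrow> 'v) \<Rightarrow> 'v) operad"
  where "End_operad scale = \<lparr>
    arity   = (\<lambda>n. {f. multilinear scale n f}),
    opzero  = (\<lambda>n x. 0),
    opadd   = (\<lambda>n f g x. f x + g x),
    opscale = (\<lambda>n c f x. scale c (f x)),
    opact   = (\<lambda>n \<sigma> f x. f (\<lambda>j. x (\<sigma> j))),
    opcomp  = (\<lambda>n m i f g x. f (\<lambda>j. if j < i then x j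
                                   else if j = i then g (\<lambda>k. x (k + i - 1))
                                   else x (j + m - 1))),
    opunit  = (\<lambda>x. x 1) \<rparr>"

definition algebra_structures ::
    "('k::field, 'p) operad \<Rightarrow> ('k \<Rightarrow> 'v::ab_group_add \<Rightarrow> 'v) \<Rightarrow> (nat \<Rightarrow> 'p \<Rightarrow> (nat \<Rightarrow> 'v) \<Rightarrow> 'v) set"
  where "algebra_structures P scale = operad_hom P (End_operad scale)"

definition bilinear_product ::
    "('k::field \<Rightarrow> 'v::ab_group_add \<Rightarrow> 'v) \<Rightarrow> ('v \<Rightarrow> 'v \<Rightarrow> 'v) \<Rightarrow> bool"
  where "bilinear_product scale \<mu> \<longleftrightarrow>
    (\<forall>a. Vector_Spaces.linear scale scale (\<lambda>b. \<mu> a b)) \<and>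
    (\<forall>b. Vector_Spaces.linear scale scale (\<lambda>a. \<mu> a b))"

definition associative_product :: "('v \<Rightarrow> 'v \<Rightarrow> 'v) \<Rightarrow> bool"
  where "associative_product \<mu> \<longleftrightarrow> (\<forall>a b c. \<mu> (\<mu> a b) c = \<mu> a (\<mu> b c))"


section \<open>The free operad on one binary operation without symmetry\<close>

datatype 'a magma = Gen 'a | Mul "'a magma" "'a magma" (infixl "\<cdot>" 75)

primrec leaves :: "'a magma \<Rightarrow> 'a list"
  where
    "leaves (Gen a) = [a]"
  | "leaves (s \<cdot> t) = leaves s @ leaves t"

primrec subst :: "('a \<Rightarrow> 'b magma) \<Rightarrow> 'a magma \<Rightarrow> 'b magma"
  where
    "subst h (Gen a) = h a"
  | "subst h (s \<cdot> t) = subst h s \<cdot> subst h t"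

text \<open>The basis of \<open>\<F>(E)(n)\<close>: bracketed words containing each of \<open>1, \<dots>, n\<close> exactly once.\<close>

definition monomials :: "nat \<Rightarrow> nat magma set"
  where "monomials n = {t. distinct (leaves t) \<and> set (leaves t) = {1..n}}"

definition graft :: "nat \<Rightarrow> nat \<Rightarrow> nat magma \<Rightarrow> nat magma \<Rightarrow> nat magma"
  where "graft m i t s =
    subst (\<lambda>j. if j < i then Gen j
               else if j = i then map_magma (\<lambda>k. k + i - 1) s
               else Gen (j + m - 1)) t"

definition monom :: "nat magma \<Rightarrow> (nat magma \<Rightarrow>\<^sub>0 'k::field)"
  where "monom t = Poly_Mapping.single t 1"

definition free_operad :: "('k::field, nat magma \<Rightarrow>\<^sub>0 'k) operad"
  where "free_operad = \<lparr>
    arity   = (\<lambda>n. {f. Poly_Mapping.keys f \<subseteq> monomials n}),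
    opzero  = (\<lambda>n. 0),
    opadd   = (\<lambda>n f g. f + g),
    opscale = (\<lambda>n c f. Poly_Mapping.map ((*) c) f),
    opact   = (\<lambda>n \<sigma> f. \<Sum>t\<in>Poly_Mapping.keys f.
                 Poly_Mapping.single (map_magma \<sigma> t) (Poly_Mapping.lookup f t)),
    opcomp  = (\<lambda>n m i f g. \<Sum>t\<in>Poly_Mapping.keys f. \<Sum>s\<in>Poly_Mapping.keys g.
                 Poly_Mapping.single (graft m i t s)
                   (Poly_Mapping.lookup f t * Poly_Mapping.lookup g s)),
    opunit  = monom (Gen 1) \<rparr>"


section \<open>Binary quadratic operads and their duals\<close>

text \<open>Here \<open>E = \<K>[\<Sigma>\<^sub>2]\<close> throughout and \<open>R \<subseteq> \<F>(E)(3)\<close>.\<close>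

definition relation_ideal :: "(nat magma \<Rightarrow>\<^sub>0 'k::field) set \<Rightarrow> nat \<Rightarrow> (nat magma \<Rightarrow>\<^sub>0 'k) set"
  where "relation_ideal R = ideal_generated free_operad 3 R"

definition quadratic_operad ::
    "(nat magma \<Rightarrow>\<^sub>0 'k::field) set \<Rightarrow> ('k, (nat magma \<Rightarrow>\<^sub>0 'k) set) operad"
  where "quadratic_operad R = quotient_operad free_operad (relation_ideal R)"

text \<open>The product of an algebra over \<open>quadratic_operad R\<close>: the action of the class of \<open>x\<^sub>1.x\<^sub>2\<close>.\<close>

definition algebra_product ::
    "(nat magma \<Rightarrow>\<^sub>0 'k::field) set \<Rightarrow>
     (nat \<Rightarrow> (nat magma \<Rightarrow>\<^sub>0 'k) set \<Rightarrow> (nat \<Rightarrow> 'v) \<Rightarrow> 'v) \<Rightarrow> 'v \<Rightarrow> 'v \<Rightarrow> 'v"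
  where "algebra_product R \<phi> a b =
    \<phi> 2 (ideal_class free_operad (relation_ideal R) 2 (monom (Gen 1 \<cdot> Gen 2)))
      (\<lambda>i. if i = 1 then a else b)"

definition sgn3 :: "nat \<Rightarrow> nat \<Rightarrow> nat \<Rightarrow> int"
  where "sgn3 i j k = sign (id(1 := i, 2 := j, 3 := k))"

fun form_weight :: "nat magma \<Rightarrow> int"
  where
    "form_weight (Gen i \<cdot> (Gen j \<cdot> Gen k)) = sgn3 i j k"
  | "form_weight ((Gen i \<cdot> Gen j) \<cdot> Gen k) = - sgn3 i j k"
  | "form_weight _ = 0"

definition pairing :: "(nat magma \<Rightarrow>\<^sub>0 'k::field) \<Rightarrow> (nat magma \<Rightarrow>\<^sub>0 'k) \<Rightarrow> 'k"
  where "pairing u v = (\<Sum>t\<in>Poly_Mapping.keys u.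
    of_int (form_weight t) * Poly_Mapping.lookup u t * Poly_Mapping.lookup v t)"

definition orth :: "(nat magma \<Rightarrow>\<^sub>0 'k::field) set \<Rightarrow> (nat magma \<Rightarrow>\<^sub>0 'k) set"
  where "orth R = {v \<in> arity free_operad 3. \<forall>u\<in>R. pairing u v = 0}"

text \<open>
  The dual of the operad presented by \<open>R\<close>, with \<open>E\<^sup>\<or>\<close> identified with \<open>E\<close>; the signature
  twist is contained in the signs of \<^const>\<open>pairing\<close>.
\<close>

definition dual_operad ::
    "(nat magma \<Rightarrow>\<^sub>0 'k::field) set \<Rightarrow> ('k, (nat magma \<Rightarrow>\<^sub>0 'k) set) operad"
  where "dual_operad R = quadratic_operad (orth R)"


section \<open>The relations\<close>

definition relations ::
    "(nat magma \<Rightarrow>\<^sub>0 'k::field) set \<Rightarrow> (nat magma \<Rightarrow>\<^sub>0 'k) set"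
  where "relations G = submodule free_operad 3 hull G"

definition rmon :: "nat \<Rightarrow> nat \<Rightarrow> nat \<Rightarrow> (nat magma \<Rightarrow>\<^sub>0 'k::field)"
  where "rmon i j k = monom (Gen i \<cdot> (Gen j \<cdot> Gen k))"

definition lmon :: "nat \<Rightarrow> nat \<Rightarrow> nat \<Rightarrow> (nat magma \<Rightarrow>\<^sub>0 'k::field)"
  where "lmon i j k = monom ((Gen i \<cdot> Gen j) \<cdot> Gen k)"

definition Vinb_relations :: "(nat magma \<Rightarrow>\<^sub>0 'k::field) set"
  where "Vinb_relations = relations {rmon 1 2 3 - lmon 1 2 3 - rmon 2 1 3 + lmon 2 1 3}"

definition G4_Ass_relations :: "(nat magma \<Rightarrow>\<^sub>0 'k::field) set"
  where "G4_Ass_relations = relations {rmon 1 2 3 - lmon 1 2 3 - rmon 3 2 1 + lmon 3 2 1}"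

definition G5_Ass_relations :: "(nat magma \<Rightarrow>\<^sub>0 'k::field) set"
  where "G5_Ass_relations = relations
    {rmon 1 2 3 - lmon 1 2 3 + rmon 2 3 1 - lmon 2 3 1 + rmon 3 1 2 - lmon 3 1 2}"

end

theory Submission
  imports Defs
begin

text \<open>
  Each of the three operads is attached to a subgroup \<open>H\<close> of the symmetric group of degree
  three, generated by the transposition \<open>(1 2)\<close>, by the transposition \<open>(1 3)\<close>, and by a 3-cycle respectively:
  its relation is the signed sum over \<open>H\<close> of the permuted associators. The proof
  treats all subgroups at once.

  In the pairing a right-bracketed and a left-bracketed word have opposite signs, and so
  they do in an associator. Writing \<open>a\<^sub>\<sigma>\<close> for the sum of the two coefficients of \<open>v\<close> at the
  word \<open>\<sigma>\<close>, the element \<open>v\<close> is therefore orthogonal to the relation translated by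
  \<open>\<sigma>\<close> if and only if \<open>\<Sum>h\<in>H. a\<^sub>\<sigma>\<^sub>h = 0\<close> (\<open>orth_signed_associator_sum\<close>): the signature twist
  of the duality has turned antisymmetry into symmetry. These equations cut out exactly the submodule generated by
  associativity and by invariance of triple products under \<open>H\<close>
  (\<open>perm_subgroup.orth_eq\<close>), which is an averaging argument over the cosets of \<open>H\<close>. This
  identifies the dual operads.

  For the algebras, two universal properties are combined. A structure over the free
  operad is the same as a bilinear product, since every monomial is obtained from
  \<open>x\<^sub>1.x\<^sub>2\<close> by partial compositions and permutations (\<open>interpretation_hom\<close>,
  \<open>hom_eq_operation\<close>). A morphism out of a quotient is a morphism that kills the
  ideal (\<open>quotient_hom_pullback\<close>, \<open>quotient_hom_lift\<close>), and since the elements acting as zero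
  form an ideal, only the generating relations have to be checked
  (\<open>algebras_of_quadratic_operad\<close>). What remains is to read the generating relations as
  identities in three elements.
\<close>

section \<open>The linear structure of the free operad\<close>

text \<open>
  The action does not depend on the arity and the partial composition does not depend on that
  of its first argument; dropping these parameters lets one rewrite rule serve all arities.
\<close>

definition relabel :: "(nat \<Rightarrow> nat) \<Rightarrow> (nat magma \<Rightarrow>\<^sub>0 'k::field) \<Rightarrow> (nat magma \<Rightarrow>\<^sub>0 'k)"
  where "relabel \<sigma> f = (\<Sum>t\<in>Poly_Mapping.keys f.
    Poly_Mapping.single (map_magma \<sigma> t) (Poly_Mapping.lookup f t))"

definition compose_at ::
    "nat \<Rightarrow> nat \<Rightarrow> (nat magma \<Rightarrow>\<^sub>0 'k::field) \<Rightarrow> (nat magma \<Rightarrow>\<^sub>0 'k) \<Rightarrow> (nat magma \<Rightarrow>\<^sub>0 'k)"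
  where "compose_at m i f g = (\<Sum>t\<in>Poly_Mapping.keys f. \<Sum>s\<in>Poly_Mapping.keys g.
    Poly_Mapping.single (graft m i t s) (Poly_Mapping.lookup f t * Poly_Mapping.lookup g s))"

lemma free_operad_simps [simp]:
  "f \<in> arity free_operad n \<longleftrightarrow> Poly_Mapping.keys f \<subseteq> monomials n"
  "opzero free_operad n = 0"
  "opadd free_operad n f g = f + g"
  "opscale free_operad n c f = Poly_Mapping.map ((*) c) f"
  "opact free_operad n \<sigma> f = relabel \<sigma> f"
  "opcomp free_operad n m i f g = compose_at m i f g"
  "opunit free_operad = monom (Gen 1)"
  by (simp_all add: free_operad_def relabel_def compose_at_def)

lemma lookup_scale [simp]:
  "Poly_Mapping.lookup (Poly_Mapping.map ((*) c) f) t = (c::'k::field) * Poly_Mapping.lookup f t"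
  by (simp add: Poly_Mapping.map.rep_eq when_def)

lemma scale_single [simp]:
  "Poly_Mapping.map ((*) (c::'k::field)) (Poly_Mapping.single t d) = Poly_Mapping.single t (c * d)"
  by (rule poly_mapping_eqI) (simp add: lookup_single when_def)

lemma keys_subset_iff:
  "Poly_Mapping.keys f \<subseteq> A \<longleftrightarrow> (\<forall>t. t \<notin> A \<longrightarrow> Poly_Mapping.lookup f t = 0)"
  by (auto simp: in_keys_iff)

lemma keys_subset_sum:
  "(\<And>x. x \<in> X \<Longrightarrow> Poly_Mapping.keys (F x) \<subseteq> A) \<Longrightarrow> Poly_Mapping.keys (sum F X) \<subseteq> A"
  by (simp add: keys_subset_iff lookup_sum)

lemma sum_monomials:
  "(\<Sum>t\<in>Poly_Mapping.keys f. Poly_Mapping.single t (Poly_Mapping.lookup f t)) = f"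
  by (rule poly_mapping_eqI)
     (simp add: lookup_sum lookup_single when_def in_keys_iff)

lemma relabel_zero [simp]: "relabel \<sigma> 0 = 0"
  by (simp add: relabel_def)

lemma relabel_single [simp]:
  "relabel \<sigma> (Poly_Mapping.single t c) = Poly_Mapping.single (map_magma \<sigma> t) c"
  by (simp add: relabel_def)

lemma relabel_add: "relabel \<sigma> (f + g) = relabel \<sigma> f + relabel \<sigma> g"
  unfolding relabel_def by (rule setsum_keys_plus_distrib) (simp_all add: single_add)

lemma relabel_uminus: "relabel \<sigma> (- f) = - relabel \<sigma> f"
  using relabel_add[of \<sigma> f "- f"] by (simp add: eq_neg_iff_add_eq_0 add.commute)

lemma relabel_diff: "relabel \<sigma> (f - g) = relabel \<sigma> f - relabel \<sigma> g"
  using relabel_add[of \<sigma> f "- g"] by (simp add: relabel_uminus)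

lemma relabel_sum: "relabel \<sigma> (sum F X) = (\<Sum>x\<in>X. relabel \<sigma> (F x))"
  by (induction X rule: infinite_finite_induct) (simp_all add: relabel_add)

lemma compose_at_single [simp]:
  "compose_at m i (Poly_Mapping.single t c) (Poly_Mapping.single s d) =
     Poly_Mapping.single (graft m i t s) (c * d)"
  by (simp add: compose_at_def)

lemma compose_at_add_left: "compose_at m i (f + f') g = compose_at m i f g + compose_at m i f' g"
  unfolding compose_at_def
  by (rule setsum_keys_plus_distrib) (simp_all add: single_add sum.distrib distrib_right)

lemma compose_at_add_right: "compose_at m i f (g + g') = compose_at m i f g + compose_at m i f g'"
proof -
  have "(\<Sum>s\<in>Poly_Mapping.keys (g + g'). Poly_Mapping.single (graft m i t s)
            (Poly_Mapping.lookup f t * Poly_Mapping.lookup (g + g') s)) =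
        (\<Sum>s\<in>Poly_Mapping.keys g. Poly_Mapping.single (graft m i t s)
            (Poly_Mapping.lookup f t * Poly_Mapping.lookup g s)) +
        (\<Sum>s\<in>Poly_Mapping.keys g'. Poly_Mapping.single (graft m i t s)
            (Poly_Mapping.lookup f t * Poly_Mapping.lookup g' s))" for t
    by (rule setsum_keys_plus_distrib) (simp_all add: single_add distrib_left)
  then show ?thesis
    by (simp add: compose_at_def sum.distrib)
qed

text \<open>
  The two-step telescope that makes composition compatible with congruence modulo an
  ideal, in both arguments at once.
\<close>

lemma compose_at_diff:
  "compose_at m i f' g' - compose_at m i f g =
     compose_at m i (f' - f) g' + compose_at m i f (g' - g)"
  using compose_at_add_left[of m i "f' - f" f g'] compose_at_add_right[of m i f "g' - g" g]
  by simp

section \<open>Closure of the arities under the operations\<close>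

lemma leaves_nonempty [simp]: "leaves t \<noteq> []"
  by (induction t) auto

lemma leaves_map_magma: "leaves (map_magma p t) = map p (leaves t)"
  by (induction t) auto

lemma set_leaves_subst: "set (leaves (subst h t)) = (\<Union>j\<in>set (leaves t). set (leaves (h j)))"
  by (induction t) auto

text \<open>
  Grafting is a substitution, so multilinearity of the composite monomial comes down to
  the substituted trees having pairwise disjoint sets of leaves.
\<close>

lemma distinct_leaves_subst:
  assumes "distinct (leaves t)"
    and "\<And>j. j \<in> set (leaves t) \<Longrightarrow> distinct (leaves (h j))"
    and "\<And>j k. j \<in> set (leaves t) \<Longrightarrow> k \<in> set (leaves t) \<Longrightarrow> j \<noteq> k \<Longrightarrow>
           set (leaves (h j)) \<inter> set (leaves (h k)) = {}"
  shows "distinct (leaves (subst h t))"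
  using assms
proof (induction t)
  case (Mul s u)
  have "set (leaves (h j)) \<inter> set (leaves (h k)) = {}"
    if "j \<in> set (leaves s)" "k \<in> set (leaves u)" for j k
  proof (rule Mul.prems(3))
    show "j \<noteq> k" using that Mul.prems(1) by auto
  qed (use that in auto)
  then show ?case
    using Mul by (auto simp: set_leaves_subst)
qed auto

lemma relabel_monomials:
  assumes "\<sigma> permutes {1..n}" "t \<in> monomials n"
  shows "map_magma \<sigma> t \<in> monomials n"
  using assms permutes_image[OF assms(1)] permutes_inj_on[OF assms(1)]
  by (auto simp: monomials_def leaves_map_magma distinct_map)

text \<open>
  The inputs of the composite split into three blocks: those below \<open>i\<close> are kept, the
  \<open>m\<close> inputs of \<open>s\<close> occupy \<open>i, \<dots>, i + m - 1\<close>, and those above \<open>i\<close> are shifted by \<open>m - 1\<close>.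
\<close>

lemma graft_monomials:
  assumes t: "t \<in> monomials n" and s: "s \<in> monomials m" and i: "i \<in> {1..n}"
  shows "graft m i t s \<in> monomials (n + m - 1)"
proof -
  let ?h = "\<lambda>j. if j < i then Gen j
               else if j = i then map_magma (\<lambda>k. k + i - 1) s
               else Gen (j + m - 1)"
  have L: "set (leaves (?h j)) = (if j < i then {j} else if j = i then {i..<i+m} else {j + m - 1})" for j
  proof -
    have "(\<lambda>k. k + i - 1) ` {1..m} = {i..<i+m}"
    proof (intro equalityI subsetI)
      fix y assume "y \<in> {i..<i+m}"
      then have "y = (y - i + 1) + i - 1" "y - i + 1 \<in> {1..m}" by auto
      then show "y \<in> (\<lambda>k. k + i - 1) ` {1..m}" by blast
    qed (use i in auto)
    then show ?thesis using s by (simp add: leaves_map_magma monomials_def)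
  qed
  have "m \<noteq> 0"
    using s leaves_nonempty[of s] unfolding monomials_def
    by (metis (mono_tags, lifting) mem_Collect_eq atLeastatMost_empty_iff not_one_le_zero set_empty)
  have lt: "distinct (leaves t)" "set (leaves t) = {1..n}"
    using t by (auto simp: monomials_def)
  have "distinct (leaves (subst ?h t))"
  proof (rule distinct_leaves_subst[OF lt(1)])
    fix j show "distinct (leaves (?h j))"
      using s i by (auto simp: leaves_map_magma monomials_def distinct_map inj_on_def)
  next
    fix j k :: nat assume "j \<noteq> k"
    then show "set (leaves (?h j)) \<inter> set (leaves (?h k)) = {}"
      unfolding L using \<open>m \<noteq> 0\<close> by auto
  qed
  moreover have "set (leaves (subst ?h t)) = {1..n + m - 1}"
  proof (intro equalityI subsetI)
    fix y assume "y \<in> set (leaves (subst ?h t))"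
    then show "y \<in> {1..n + m - 1}"
      unfolding set_leaves_subst lt L using i by (auto split: if_splits)
  next
    fix y assume y: "y \<in> {1..n + m - 1}"
    \<comment> \<open>the input of \<open>t\<close> whose block contains \<open>y\<close>\<close>
    define j where "j = (if y < i then y else if y < i + m then i else y - m + 1)"
    have "j \<in> {1..n}" "y \<in> set (leaves (?h j))"
      unfolding L using y i \<open>m \<noteq> 0\<close> by (auto simp: j_def)
    then show "y \<in> set (leaves (subst ?h t))"
      unfolding set_leaves_subst lt by blast
  qed
  ultimately show ?thesis
    by (simp add: graft_def monomials_def)
qed

lemma keys_relabel:
  assumes "\<sigma> permutes {1..n}" "Poly_Mapping.keys f \<subseteq> monomials n"
  shows "Poly_Mapping.keys (relabel \<sigma> f) \<subseteq> monomials n"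
  unfolding relabel_def
  by (intro keys_subset_sum) (use assms relabel_monomials in auto)

lemma keys_compose_at:
  assumes "Poly_Mapping.keys f \<subseteq> monomials n" "Poly_Mapping.keys g \<subseteq> monomials m" "i \<in> {1..n}"
  shows "Poly_Mapping.keys (compose_at m i f g) \<subseteq> monomials (n + m - 1)"
  unfolding compose_at_def
  by (intro keys_subset_sum) (use assms graft_monomials[OF _ _ assms(3)] in \<open>auto simp: subset_iff\<close>)

lemma keys_diff_subset:
  "Poly_Mapping.keys f \<subseteq> A \<Longrightarrow> Poly_Mapping.keys g \<subseteq> A \<Longrightarrow> Poly_Mapping.keys (f - g) \<subseteq> A"
  by (simp add: keys_subset_iff lookup_minus)

section \<open>Submodules and operadic ideals\<close>

lemma submodule_free_iff:
  "submodule free_operad n M \<longleftrightarrow>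
    (\<forall>f\<in>M. Poly_Mapping.keys f \<subseteq> monomials n) \<and> 0 \<in> M \<and> (\<forall>f\<in>M. \<forall>g\<in>M. f + g \<in> M) \<and>
    (\<forall>c. \<forall>f\<in>M. Poly_Mapping.map ((*) c) f \<in> M) \<and>
    (\<forall>\<sigma>. \<sigma> permutes {1..n} \<longrightarrow> (\<forall>f\<in>M. relabel \<sigma> f \<in> M))"
  unfolding submodule_def by (auto simp: subset_iff)

lemma submoduleD:
  assumes "submodule free_operad n M"
  shows "f \<in> M \<Longrightarrow> Poly_Mapping.keys f \<subseteq> monomials n"
    and "0 \<in> M"
    and "f \<in> M \<Longrightarrow> g \<in> M \<Longrightarrow> f + g \<in> M"
    and "f \<in> M \<Longrightarrow> Poly_Mapping.map ((*) c) f \<in> M"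
    and "f \<in> M \<Longrightarrow> \<sigma> permutes {1..n} \<Longrightarrow> relabel \<sigma> f \<in> M"
  using assms unfolding submodule_free_iff by blast+

lemma submodule_uminus:
  assumes "submodule free_operad n M" "f \<in> M"
  shows "- f \<in> M"
proof -
  have "- f = Poly_Mapping.map ((*) (-1)) f"
    by (rule poly_mapping_eqI) simp
  then show ?thesis using submoduleD(4)[OF assms] by simp
qed

lemma submodule_diff:
  assumes "submodule free_operad n M" "f \<in> M" "g \<in> M"
  shows "f - g \<in> M"
proof -
  have "f + - g \<in> M"
    using submoduleD(3)[OF assms(1,2) submodule_uminus[OF assms(1,3)]] .
  then show ?thesis by simp
qed

lemma submodule_sum:
  assumes "submodule free_operad n M" "\<And>x. x \<in> X \<Longrightarrow> F x \<in> M"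
  shows "sum F X \<in> M"
  using assms(2) by (induction X rule: infinite_finite_induct)
    (simp_all add: submoduleD[OF assms(1)])

lemma submodule_arity: "submodule free_operad n (arity free_operad n)"
  unfolding submodule_free_iff
proof (intro conjI allI ballI impI)
  fix \<sigma> :: "nat \<Rightarrow> nat" and f :: "nat magma \<Rightarrow>\<^sub>0 'a"
  assume "\<sigma> permutes {1..n}" "f \<in> arity free_operad n"
  then show "relabel \<sigma> f \<in> arity free_operad n"
    using keys_relabel by simp
qed (simp_all add: keys_subset_iff lookup_add)

lemma submodule_Inter:
  assumes "C \<noteq> {}" and C: "\<And>M. M \<in> C \<Longrightarrow> submodule free_operad n M"
  shows "submodule free_operad n (\<Inter>C)"
  unfolding submodule_free_iff
proof (intro conjI allI ballI impI)
  fix f assume "f \<in> \<Inter>C"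
  then show "Poly_Mapping.keys f \<subseteq> monomials n"
    using assms(1) submoduleD(1)[OF C] by blast
qed (use submoduleD(2-5)[OF C] in blast)+

lemma submodule_relations:
  assumes "G \<subseteq> arity free_operad 3"
  shows "submodule free_operad 3 (relations G)"
proof -
  have "arity free_operad 3 \<in> {M. submodule free_operad 3 M \<and> G \<subseteq> M}"
    using assms submodule_arity by blast
  then show ?thesis
    unfolding relations_def hull_def by (intro submodule_Inter) blast+
qed

lemma relations_minimal: "submodule free_operad 3 M \<Longrightarrow> G \<subseteq> M \<Longrightarrow> relations G \<subseteq> M"
  unfolding relations_def by (rule hull_minimal)

lemma relations_superset: "G \<subseteq> relations G"
  unfolding relations_def by (rule hull_subset)

lemmas free_arity_add = submoduleD(3)[OF submodule_arity]
  and free_arity_scale = submoduleD(4)[OF submodule_arity]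
  and free_arity_relabel = submoduleD(5)[OF submodule_arity]

lemma free_arity_compose_at:
  "f \<in> arity free_operad n \<Longrightarrow> g \<in> arity free_operad m \<Longrightarrow> i \<in> {1..n} \<Longrightarrow>
    compose_at m i f g \<in> arity free_operad (n + m - 1)"
  using keys_compose_at unfolding free_operad_simps by blast

lemma free_arity_unit: "monom (Gen 1) \<in> arity free_operad 1"
  by (simp add: monom_def monomials_def)

lemma operadic_ideal_arity: "operadic_ideal free_operad (arity free_operad)"
  unfolding operadic_ideal_def unfolding free_operad_simps(6)
  using submodule_arity free_arity_compose_at by blast

text \<open>
  An intersection of ideals is an ideal, once the family is known to be nonempty: the
  whole operad belongs to it because the relations have arity three.
\<close>

lemma operadic_ideal_relation_ideal:
  assumes "R \<subseteq> arity free_operad 3"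
  shows "operadic_ideal free_operad (relation_ideal R)"
proof -
  let ?C = "{I. operadic_ideal free_operad I \<and> R \<subseteq> I 3}"
  have C: "arity free_operad \<in> ?C"
    using assms operadic_ideal_arity by blast
  have eq: "relation_ideal R n = (\<Inter>I\<in>?C. I n)" for n
    unfolding relation_ideal_def ideal_generated_def by blast
  have "submodule free_operad n (relation_ideal R n)" for n
    unfolding eq by (rule submodule_Inter) (use C in \<open>auto simp: operadic_ideal_def\<close>)
  moreover have "opcomp free_operad n m i f g \<in> relation_ideal R (n + m - 1)"
    if "i \<in> {1..n}" "f \<in> arity free_operad n" "g \<in> arity free_operad m"
      "f \<in> relation_ideal R n \<or> g \<in> relation_ideal R m" for n m i f g
    unfolding eq
  proof (rule INT_I)
    fix I assume I: "I \<in> ?C"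
    then have "f \<in> I n \<or> g \<in> I m" using that(4) unfolding eq by blast
    then show "opcomp free_operad n m i f g \<in> I (n + m - 1)"
      using I that(1-3) unfolding operadic_ideal_def by blast
  qed
  ultimately show ?thesis unfolding operadic_ideal_def by blast
qed

lemma relation_ideal_superset: "R \<subseteq> relation_ideal R 3"
  unfolding relation_ideal_def ideal_generated_def by blast

lemma relation_ideal_minimal:
  "operadic_ideal free_operad I \<Longrightarrow> R \<subseteq> I 3 \<Longrightarrow> relation_ideal R n \<subseteq> I n"
  unfolding relation_ideal_def ideal_generated_def by blast

section \<open>Quotients of the free operad\<close>

lemma operad_homD:
  assumes "\<phi> \<in> operad_hom P Q"
  shows "\<phi> n \<in> extensional (arity P n)"
    and "f \<in> arity P n \<Longrightarrow> \<phi> n f \<in> arity Q n"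
    and "f \<in> arity P n \<Longrightarrow> g \<in> arity P n \<Longrightarrow> \<phi> n (opadd P n f g) = opadd Q n (\<phi> n f) (\<phi> n g)"
    and "f \<in> arity P n \<Longrightarrow> \<phi> n (opscale P n c f) = opscale Q n c (\<phi> n f)"
    and "\<sigma> permutes {1..n} \<Longrightarrow> f \<in> arity P n \<Longrightarrow> \<phi> n (opact P n \<sigma> f) = opact Q n \<sigma> (\<phi> n f)"
    and "i \<in> {1..n} \<Longrightarrow> f \<in> arity P n \<Longrightarrow> g \<in> arity P m \<Longrightarrow>
      \<phi> (n + m - 1) (opcomp P n m i f g) = opcomp Q n m i (\<phi> n f) (\<phi> m g)"
    and "\<phi> 1 (opunit P) = opunit Q"
  using assms unfolding operad_hom_def PiE_iff by blast+

context
  fixes I :: "nat \<Rightarrow> (nat magma \<Rightarrow>\<^sub>0 'k::field) set"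
  assumes ideal: "operadic_ideal free_operad I"
begin

abbreviation cls :: "nat \<Rightarrow> (nat magma \<Rightarrow>\<^sub>0 'k) \<Rightarrow> (nat magma \<Rightarrow>\<^sub>0 'k) set"
  where "cls \<equiv> ideal_class free_operad I"

abbreviation Quot :: "('k, (nat magma \<Rightarrow>\<^sub>0 'k) set) operad"
  where "Quot \<equiv> quotient_operad free_operad I"

lemma ideal_submodule: "submodule free_operad n (I n)"
  using ideal by (simp add: operadic_ideal_def)

lemma mem_ideal_class: "f' \<in> cls n f \<longleftrightarrow> f' - f \<in> I n"
  unfolding ideal_class_def by (force simp: image_iff)

lemma ideal_class_eq_iff:
  "cls n f = cls n g \<longleftrightarrow> f - g \<in> I n"
proof
  assume "cls n f = cls n g"
  then show "f - g \<in> I n"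
    using submoduleD(2)[OF ideal_submodule, of n] mem_ideal_class[of f n f] mem_ideal_class[of f n g]
    by simp
next
  assume fg: "f - g \<in> I n"
  have "h - f \<in> I n \<longleftrightarrow> h - g \<in> I n" for h
  proof
    assume "h - f \<in> I n"
    then have "(h - f) + (f - g) \<in> I n"
      using fg submoduleD(3)[OF ideal_submodule] by blast
    then show "h - g \<in> I n" by simp
  next
    assume "h - g \<in> I n"
    then have "(h - g) - (f - g) \<in> I n"
      using fg submodule_diff[OF ideal_submodule] by blast
    then show "h - f \<in> I n" by simp
  qed
  then show "cls n f = cls n g"
    by (auto simp: mem_ideal_class)
qed

lemma ideal_class_self: "f \<in> cls n f"
  using submoduleD(2)[OF ideal_submodule] by (simp add: mem_ideal_class)

lemma ideal_class_nonempty: "cls n f \<noteq> {}"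
  using ideal_class_self by blast

lemma compose_at_ideal:
  assumes "i \<in> {1..n}" "f \<in> arity free_operad n" "g \<in> arity free_operad m"
    and "f \<in> I n \<or> g \<in> I m"
  shows "compose_at m i f g \<in> I (n + m - 1)"
  using ideal assms unfolding operadic_ideal_def free_operad_simps(6) by blast

lemma quotient_add:
  "opadd Quot n (cls n f) (cls n g)
     = cls n (f + g)"
proof -
  have "cls n (f' + g') = cls n (f + g)"
    if "f' \<in> cls n f" "g' \<in> cls n g" for f' g'
  proof -
    have "(f' - f) + (g' - g) \<in> I n"
      using that submoduleD(3)[OF ideal_submodule] by (simp add: mem_ideal_class)
    then show ?thesis by (simp add: ideal_class_eq_iff algebra_simps)
  qed
  then show ?thesis
    unfolding quotient_operad_def by (simp add: ideal_class_nonempty)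
qed

lemma quotient_scale:
  "opscale Quot n c (cls n f)
     = cls n (Poly_Mapping.map ((*) c) f)"
proof -
  have "cls n (Poly_Mapping.map ((*) c) f') =
      cls n (Poly_Mapping.map ((*) c) f)"
    if "f' \<in> cls n f" for f'
  proof -
    have "Poly_Mapping.map ((*) c) (f' - f) = Poly_Mapping.map ((*) c) f' - Poly_Mapping.map ((*) c) f"
      by (rule poly_mapping_eqI) (simp add: lookup_minus right_diff_distrib)
    then show ?thesis
      using that submoduleD(4)[OF ideal_submodule, of "f' - f" n c]
      by (simp add: mem_ideal_class ideal_class_eq_iff)
  qed
  then show ?thesis
    unfolding quotient_operad_def by (simp add: ideal_class_nonempty)
qed

lemma quotient_act:
  assumes "\<sigma> permutes {1..n}"
  shows "opact Quot n \<sigma> (cls n f)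
     = cls n (relabel \<sigma> f)"
proof -
  have "cls n (relabel \<sigma> f') = cls n (relabel \<sigma> f)"
    if "f' \<in> cls n f" for f'
    using that submoduleD(5)[OF ideal_submodule _ assms, of "f' - f"]
    by (simp add: mem_ideal_class ideal_class_eq_iff relabel_diff)
  then show ?thesis
    unfolding quotient_operad_def by (simp add: ideal_class_nonempty)
qed

text \<open>
  The quotient operations are unions over all representatives; the ideal axioms make
  all the classes in the union equal.
\<close>

lemma quotient_comp:
  assumes i: "i \<in> {1..n}"
    and f: "f \<in> arity free_operad n" and g: "g \<in> arity free_operad m"
  shows "opcomp Quot n m i
      (cls n f) (cls m g)
     = cls (n + m - 1) (compose_at m i f g)"
proof -
  have "cls (n + m - 1) (compose_at m i f' g') =
      cls (n + m - 1) (compose_at m i f g)"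
    if f': "f' \<in> cls n f" and g': "g' \<in> cls m g" for f' g'
  proof -
    have df: "f' - f \<in> I n" and dg: "g' - g \<in> I m"
      using f' g' by (simp_all add: mem_ideal_class)
    then have kf: "f' - f \<in> arity free_operad n" and kg: "g' - g \<in> arity free_operad m"
      using submoduleD(1)[OF ideal_submodule] unfolding free_operad_simps by blast+
    have kg': "g' \<in> arity free_operad m"
      using free_arity_add[OF kg g] by simp
    have "compose_at m i (f' - f) g' + compose_at m i f (g' - g) \<in> I (n + m - 1)"
      using compose_at_ideal[OF i kf kg'] compose_at_ideal[OF i f kg] df dg
        submoduleD(3)[OF ideal_submodule] by blast
    then show ?thesis
      by (simp add: ideal_class_eq_iff compose_at_diff)
  qed
  then show ?thesis
    unfolding quotient_operad_def by (simp add: ideal_class_nonempty)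
qed

lemma quotient_arity:
  "arity Quot n = cls n ` arity free_operad n"
  by (simp add: quotient_operad_def)

lemma quotient_unit:
  "opunit Quot = cls 1 (monom (Gen 1))"
  by (simp add: quotient_operad_def)

text \<open>
  Together with \<open>quotient_hom_lift\<close> below, this is the universal property of the quotient:
  morphisms out of it are the morphisms out of the free operad that identify congruent
  elements. The restriction is there because morphisms are extensional.
\<close>

lemma quotient_hom_pullback:
  assumes \<phi>: "\<phi> \<in> operad_hom Quot Q"
  shows "(\<lambda>n. \<lambda>f\<in>arity free_operad n. \<phi> n (cls n f)) \<in> operad_hom free_operad Q"
proof -
  let ?\<psi> = "\<lambda>n. \<lambda>f\<in>arity free_operad n. \<phi> n (cls n f)"
  have cl: "cls n f \<in> arity Quot n"
    if "f \<in> arity free_operad n" for n and f :: "nat magma \<Rightarrow>\<^sub>0 'k"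
    using that unfolding quotient_arity by (rule imageI)
  show ?thesis
    unfolding operad_hom_def mem_Collect_eq
  proof (intro conjI allI ballI impI)
    fix n show "?\<psi> n \<in> arity free_operad n \<rightarrow>\<^sub>E arity Q n"
      using operad_homD(2)[OF \<phi> cl] by (auto simp del: free_operad_simps)
  next
    fix n and f g :: "nat magma \<Rightarrow>\<^sub>0 'k"
    assume fg: "f \<in> arity free_operad n" "g \<in> arity free_operad n"
    have "\<phi> n (opadd Quot n (cls n f) (cls n g))
       = opadd Q n (\<phi> n (cls n f)) (\<phi> n (cls n g))"
      using \<phi> cl[OF fg(1)] cl[OF fg(2)] by (auto intro: operad_homD)
    then show "?\<psi> n (opadd free_operad n f g) =
        opadd Q n (?\<psi> n f) (?\<psi> n g)"
      using fg free_arity_add[OF fg] by (simp add: quotient_add del: free_operad_simps(1))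
  next
    fix n c and f :: "nat magma \<Rightarrow>\<^sub>0 'k"
    assume f: "f \<in> arity free_operad n"
    have "\<phi> n (opscale Quot n c (cls n f))
       = opscale Q n c (\<phi> n (cls n f))"
      using \<phi> cl[OF f] by (auto intro: operad_homD)
    then show "?\<psi> n (opscale free_operad n c f) =
        opscale Q n c (?\<psi> n f)"
      using f free_arity_scale[OF f] by (simp add: quotient_scale del: free_operad_simps(1))
  next
    fix n \<sigma> and f :: "nat magma \<Rightarrow>\<^sub>0 'k"
    assume \<sigma>: "\<sigma> permutes {1..n}" and f: "f \<in> arity free_operad n"
    have "\<phi> n (opact Quot n \<sigma> (cls n f))
       = opact Q n \<sigma> (\<phi> n (cls n f))"
      using \<phi> \<sigma> cl[OF f] by (auto intro: operad_homD)
    then show "?\<psi> n (opact free_operad n \<sigma> f) =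
        opact Q n \<sigma> (?\<psi> n f)"
      using f \<sigma> free_arity_relabel[OF f \<sigma>] by (simp add: quotient_act del: free_operad_simps(1))
  next
    fix n m i and f g :: "nat magma \<Rightarrow>\<^sub>0 'k"
    assume i: "i \<in> {1..n}" and f: "f \<in> arity free_operad n" and g: "g \<in> arity free_operad m"
    have "\<phi> (n + m - 1) (opcomp Quot n m i (cls n f) (cls m g))
       = opcomp Q n m i (\<phi> n (cls n f)) (\<phi> m (cls m g))"
      by (rule operad_homD(6)[OF \<phi> i cl[OF f] cl[OF g]])
    then show "?\<psi> (n + m - 1) (opcomp free_operad n m i f g) =
        opcomp Q n m i (?\<psi> n f) (?\<psi> m g)"
      using f g i free_arity_compose_at[OF f g i] by (simp add: quotient_comp del: free_operad_simps(1))
  next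
    show "?\<psi> 1 (opunit free_operad) = opunit Q"
      using \<phi> free_arity_unit quotient_unit unfolding operad_hom_def by (simp add: monom_def)
  qed
qed

text \<open>
  The value on a class is read off at a chosen representative; \<open>kill\<close> makes the choice
  irrelevant.
\<close>

lemma quotient_hom_lift:
  assumes \<psi>: "\<psi> \<in> operad_hom free_operad Q"
    and kill: "\<And>n f g. f \<in> arity free_operad n \<Longrightarrow> g \<in> arity free_operad n \<Longrightarrow>
      f - g \<in> I n \<Longrightarrow> \<psi> n f = \<psi> n g"
  obtains \<phi> where "\<phi> \<in> operad_hom Quot Q"
    and "\<And>n f. f \<in> arity free_operad n \<Longrightarrow> \<phi> n (cls n f) = \<psi> n f"
proof -
  define \<phi> where "\<phi> n = (\<lambda>A\<in>arity Quot n.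
    \<psi> n (SOME f. f \<in> arity free_operad n \<and> A = cls n f))" for n
  have ev: "\<phi> n (cls n f) = \<psi> n f" if f: "f \<in> arity free_operad n" for n f
  proof -
    let ?g = "SOME g. g \<in> arity free_operad n \<and> cls n f = cls n g"
    have "?g \<in> arity free_operad n \<and> cls n f = cls n ?g"
      by (rule someI[of _ f]) (use f in blast)
    then have "\<psi> n f = \<psi> n ?g"
      using kill[OF f] by (simp add: ideal_class_eq_iff del: free_operad_simps)
    then show ?thesis
      using f by (simp add: \<phi>_def quotient_arity del: free_operad_simps)
  qed
  have "\<phi> \<in> operad_hom Quot Q"
    unfolding operad_hom_def mem_Collect_eq quotient_arity ball_simps
  proof (intro conjI allI ballI impI)
    fix n
    have "\<phi> n A \<in> arity Q n" if "A \<in> cls n ` arity free_operad n" for A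
      using that operad_homD(2)[OF \<psi>] ev by (auto simp del: free_operad_simps)
    then show "\<phi> n \<in> cls n ` arity free_operad n \<rightarrow>\<^sub>E arity Q n"
      unfolding \<phi>_def quotient_arity by (auto simp del: free_operad_simps)
  next
    fix n and f g :: "nat magma \<Rightarrow>\<^sub>0 'k"
    assume fg: "f \<in> arity free_operad n" "g \<in> arity free_operad n"
    have "\<psi> n (f + g) = opadd Q n (\<psi> n f) (\<psi> n g)"
      using operad_homD(3)[OF \<psi> fg] by simp
    then show "\<phi> n (opadd Quot n (cls n f) (cls n g))
       = opadd Q n (\<phi> n (cls n f)) (\<phi> n (cls n g))"
      by (simp only: quotient_add ev[OF free_arity_add[OF fg]] ev[OF fg(1)] ev[OF fg(2)])
  next
    fix n c and f :: "nat magma \<Rightarrow>\<^sub>0 'k"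
    assume f: "f \<in> arity free_operad n"
    have "\<psi> n (Poly_Mapping.map ((*) c) f) = opscale Q n c (\<psi> n f)"
      using operad_homD(4)[OF \<psi> f] by simp
    then show "\<phi> n (opscale Quot n c (cls n f))
       = opscale Q n c (\<phi> n (cls n f))"
      by (simp only: quotient_scale ev[OF free_arity_scale[OF f]] ev[OF f])
  next
    fix n \<sigma> and f :: "nat magma \<Rightarrow>\<^sub>0 'k"
    assume \<sigma>: "\<sigma> permutes {1..n}" and f: "f \<in> arity free_operad n"
    have "\<psi> n (relabel \<sigma> f) = opact Q n \<sigma> (\<psi> n f)"
      using operad_homD(5)[OF \<psi> \<sigma> f] by simp
    then show "\<phi> n (opact Quot n \<sigma> (cls n f))
       = opact Q n \<sigma> (\<phi> n (cls n f))"
      by (simp only: quotient_act[OF \<sigma>] ev[OF free_arity_relabel[OF f \<sigma>]] ev[OF f])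
  next
    fix n m i and f g :: "nat magma \<Rightarrow>\<^sub>0 'k"
    assume i: "i \<in> {1..n}" and f: "f \<in> arity free_operad n" and g: "g \<in> arity free_operad m"
    have "\<psi> (n + m - 1) (compose_at m i f g) = opcomp Q n m i (\<psi> n f) (\<psi> m g)"
      using operad_homD(6)[OF \<psi> i f g] by simp
    then show "\<phi> (n + m - 1) (opcomp Quot n m i (cls n f) (cls m g))
       = opcomp Q n m i (\<phi> n (cls n f)) (\<phi> m (cls m g))"
      using f g i by (simp only: quotient_comp ev[OF free_arity_compose_at[OF f g i]] ev[OF f] ev[OF g])
  next
    show "\<phi> 1 (opunit Quot) = opunit Q"
      unfolding quotient_unit ev[OF free_arity_unit] using operad_homD(7)[OF \<psi>] by simp
  qed
  then show ?thesis using ev that by blast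
qed

end

section \<open>Algebras over the free operad\<close>

primrec eval :: "('v \<Rightarrow> 'v \<Rightarrow> 'v) \<Rightarrow> ('a \<Rightarrow> 'v) \<Rightarrow> 'a magma \<Rightarrow> 'v"
  where
    "eval \<mu> x (Gen a) = x a"
  | "eval \<mu> x (s \<cdot> t) = \<mu> (eval \<mu> x s) (eval \<mu> x t)"

lemma eval_cong: "(\<And>a. a \<in> set (leaves t) \<Longrightarrow> x a = y a) \<Longrightarrow> eval \<mu> x t = eval \<mu> y t"
  by (induction t) auto

lemma eval_map_magma: "eval \<mu> x (map_magma p t) = eval \<mu> (\<lambda>a. x (p a)) t"
  by (induction t) auto

lemma eval_subst: "eval \<mu> x (subst h t) = eval \<mu> (\<lambda>a. eval \<mu> x (h a)) t"
  by (induction t) auto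

lemma subst_map_magma: "subst h (map_magma p t) = subst (\<lambda>a. h (p a)) t"
  by (induction t) auto

lemma subst_Gen: "(\<And>a. a \<in> set (leaves t) \<Longrightarrow> h a = Gen a) \<Longrightarrow> subst h t = t"
  by (induction t) auto

lemma eval_graft:
  "eval \<mu> x (graft m i t s) =
    eval \<mu> (\<lambda>j. if j < i then x j
                else if j = i then eval \<mu> (\<lambda>k. x (k + i - 1)) s
                else x (j + m - 1)) t"
  unfolding graft_def eval_subst by (rule eval_cong) (simp add: eval_map_magma)

definition operation ::
    "('k::field \<Rightarrow> 'v::ab_group_add \<Rightarrow> 'v) \<Rightarrow> ('v \<Rightarrow> 'v \<Rightarrow> 'v) \<Rightarrow> (nat magma \<Rightarrow>\<^sub>0 'k) \<Rightarrow> (nat \<Rightarrow> 'v) \<Rightarrow> 'v"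
  where "operation scale \<mu> f x =
    (\<Sum>t\<in>Poly_Mapping.keys f. scale (Poly_Mapping.lookup f t) (eval \<mu> x t))"

text \<open>
  Restricted to the arities because morphisms of operads are extensional.
\<close>

definition interpretation_of ::
    "('k::field \<Rightarrow> 'v::ab_group_add \<Rightarrow> 'v) \<Rightarrow> ('v \<Rightarrow> 'v \<Rightarrow> 'v) \<Rightarrow> nat \<Rightarrow> (nat magma \<Rightarrow>\<^sub>0 'k) \<Rightarrow> (nat \<Rightarrow> 'v) \<Rightarrow> 'v"
  where "interpretation_of scale \<mu> n = restrict (operation scale \<mu>) (arity free_operad n)"

lemma End_operad_simps [simp]:
  "f \<in> arity (End_operad scale) n \<longleftrightarrow> multilinear scale n f"
  "opzero (End_operad scale) n = (\<lambda>x. 0)"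
  "opadd (End_operad scale) n f g = (\<lambda>x. f x + g x)"
  "opscale (End_operad scale) n c f = (\<lambda>x. scale c (f x))"
  "opact (End_operad scale) n \<sigma> f = (\<lambda>x. f (\<lambda>j. x (\<sigma> j)))"
  "opcomp (End_operad scale) n m i f g = (\<lambda>x. f (\<lambda>j. if j < i then x j
      else if j = i then g (\<lambda>k. x (k + i - 1)) else x (j + m - 1)))"
  "opunit (End_operad scale) = (\<lambda>x. x 1)"
  by (simp_all add: End_operad_def)

lemma multilinear_cong:
  "multilinear scale n f \<Longrightarrow> (\<And>i. i \<in> {1..n} \<Longrightarrow> x i = y i) \<Longrightarrow> f x = f y"
  unfolding multilinear_def by blast

lemma multilinear_linear:
  "multilinear scale n f \<Longrightarrow> i \<in> {1..n} \<Longrightarrow> Vector_Spaces.linear scale scale (\<lambda>v. f (x(i := v)))"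
  unfolding multilinear_def by blast

context
  fixes scale :: "'k::field \<Rightarrow> 'v::ab_group_add \<Rightarrow> 'v"
  assumes vs: "vector_space scale"
begin

lemma operation_zero [simp]: "operation scale \<mu> 0 x = 0"
  by (simp add: operation_def)

lemma operation_single [simp]: "operation scale \<mu> (Poly_Mapping.single t c) x = scale c (eval \<mu> x t)"
proof -
  interpret vector_space scale by (rule vs)
  show ?thesis by (simp add: operation_def)
qed

lemma operation_monom [simp]: "operation scale \<mu> (monom t) x = eval \<mu> x t"
proof -
  interpret vector_space scale by (rule vs)
  show ?thesis by (simp add: monom_def)
qed

lemma operation_add: "operation scale \<mu> (f + g) x = operation scale \<mu> f x + operation scale \<mu> g x"
proof -
  interpret vector_space scale by (rule vs)
  show ?thesis
    unfolding operation_def by (rule setsum_keys_plus_distrib) (simp_all add: scale_left_distrib)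
qed

lemma operation_diff: "operation scale \<mu> (f - g) x = operation scale \<mu> f x - operation scale \<mu> g x"
  using operation_add[of \<mu> "f - g" g x] by simp

lemma operation_sum: "operation scale \<mu> (sum F X) x = (\<Sum>a\<in>X. operation scale \<mu> (F a) x)"
  by (induction X rule: infinite_finite_induct) (simp_all add: operation_add)

lemma operation_scale:
  "operation scale \<mu> (Poly_Mapping.map ((*) c) f) x = scale c (operation scale \<mu> f x)"
proof -
  interpret vector_space scale by (rule vs)
  have "operation scale \<mu> (Poly_Mapping.map ((*) c) f) x =
      (\<Sum>t\<in>Poly_Mapping.keys f. scale (c * Poly_Mapping.lookup f t) (eval \<mu> x t))"
    unfolding operation_def
    by (rule sum.mono_neutral_cong_left) (auto simp: in_keys_iff)
  then show ?thesis
    by (simp add: operation_def scale_sum_right)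
qed

lemma operation_relabel: "operation scale \<mu> (relabel \<sigma> f) x = operation scale \<mu> f (\<lambda>j. x (\<sigma> j))"
  by (simp add: relabel_def operation_sum eval_map_magma operation_def[of scale \<mu> f])

lemma linear_sum_scale:
  assumes "Vector_Spaces.linear scale scale h"
  shows "h (\<Sum>s\<in>X. scale (c s) (v s)) = (\<Sum>s\<in>X. scale (c s) (h (v s)))"
proof -
  interpret Vector_Spaces.linear scale scale h by (rule assms)
  show ?thesis by (simp add: sum scale)
qed

text \<open>
  Each input occurs in exactly one of the two factors of a product tree, so linearity
  passes from that factor through the corresponding argument of \<open>\<mu>\<close>.
\<close>

lemma linear_eval:
  assumes "bilinear_product scale \<mu>" "distinct (leaves t)" "i \<in> set (leaves t)"
  shows "Vector_Spaces.linear scale scale (\<lambda>v. eval \<mu> (x(i := v)) t)"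
  using assms(2,3)
proof (induction t)
  case (Gen a)
  then show ?case using vs by (simp add: Vector_Spaces.linear_iff)
next
  case (Mul s u)
  have indep: "eval \<mu> (x(i := v)) r = eval \<mu> x r" if "i \<notin> set (leaves r)" for v r
    by (rule eval_cong) (use that in auto)
  show ?case
  proof (cases "i \<in> set (leaves s)")
    case True
    then have "i \<notin> set (leaves u)" using Mul.prems by auto
    note indep[OF this]
    then have "(\<lambda>v. eval \<mu> (x(i := v)) (s \<cdot> u)) =
        (\<lambda>a. \<mu> a (eval \<mu> x u)) \<circ> (\<lambda>v. eval \<mu> (x(i := v)) s)"
      by (simp only: eval.simps o_def)
    moreover have "Vector_Spaces.linear scale scale (\<lambda>a. \<mu> a (eval \<mu> x u))"
      using assms(1) by (simp add: bilinear_product_def)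
    moreover have "Vector_Spaces.linear scale scale (\<lambda>v. eval \<mu> (x(i := v)) s)"
      by (rule Mul.IH(1)) (use True Mul.prems in auto)
    ultimately show ?thesis
      by (metis Vector_Spaces.linear_compose)
  next
    case False
    note indep[OF this]
    then have "(\<lambda>v. eval \<mu> (x(i := v)) (s \<cdot> u)) =
        (\<lambda>b. \<mu> (eval \<mu> x s) b) \<circ> (\<lambda>v. eval \<mu> (x(i := v)) u)"
      by (simp only: eval.simps o_def)
    moreover have "Vector_Spaces.linear scale scale (\<lambda>b. \<mu> (eval \<mu> x s) b)"
      using assms(1) by (simp add: bilinear_product_def)
    moreover have "Vector_Spaces.linear scale scale (\<lambda>v. eval \<mu> (x(i := v)) u)"
      by (rule Mul.IH(2)) (use False Mul.prems in auto)
    ultimately show ?thesis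
      by (metis Vector_Spaces.linear_compose)
  qed
qed

lemma multilinear_operation:
  assumes "bilinear_product scale \<mu>" "f \<in> arity free_operad n"
  shows "multilinear scale n (operation scale \<mu> f)"
  unfolding multilinear_def
proof (intro conjI allI ballI impI)
  have keys: "distinct (leaves t) \<and> set (leaves t) = {1..n}" if "t \<in> Poly_Mapping.keys f" for t
    using assms(2) that by (auto simp: monomials_def)
  fix x y :: "nat \<Rightarrow> 'v" assume "\<forall>i\<in>{1..n}. x i = y i"
  then show "operation scale \<mu> f x = operation scale \<mu> f y"
    unfolding operation_def by (intro sum.cong refl arg_cong2[where f = scale] eval_cong) (use keys in blast)
next
  have keys: "distinct (leaves t) \<and> set (leaves t) = {1..n}" if "t \<in> Poly_Mapping.keys f" for t
    using assms(2) that by (auto simp: monomials_def)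
  interpret vector_space_pair scale scale by (rule vector_space_pair.intro[OF vs vs])
  fix i x assume "i \<in> {1..n}"
  then show "Vector_Spaces.linear scale scale (\<lambda>v. operation scale \<mu> f (x(i := v)))"
    unfolding operation_def
    by (intro linear_compose_sum linear_compose_scale_right ballI linear_eval assms(1)) (use keys in auto)
qed

text \<open>
  Partial composition in the endomorphism operad inserts the sum defining the operation
  of \<open>g\<close> into one input; linearity of every monomial of \<open>f\<close> in that input turns this into
  the double sum over pairs of monomials that defines the composite.
\<close>

lemma operation_compose_at:
  assumes \<mu>: "bilinear_product scale \<mu>"
    and f: "f \<in> arity free_operad n" and i: "i \<in> {1..n}"
  shows "operation scale \<mu> (compose_at m i f g) x =
    operation scale \<mu> f (\<lambda>j. if j < i then x j
      else if j = i then operation scale \<mu> g (\<lambda>k. x (k + i - 1)) else x (j + m - 1))"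
proof -
  interpret vector_space scale by (rule vs)
  let ?X = "\<lambda>j. if j < i then x j else x (j + m - 1)"
  let ?c = "Poly_Mapping.lookup f" and ?d = "Poly_Mapping.lookup g"
  \<comment> \<open>written as an update at \<open>i\<close> so that linearity in input \<open>i\<close> applies\<close>
  have X: "(\<lambda>j. if j < i then x j else if j = i then v else x (j + m - 1)) = ?X(i := v)" for v
    by auto
  have "eval \<mu> (?X(i := operation scale \<mu> g (\<lambda>k. x (k + i - 1)))) t =
      (\<Sum>s\<in>Poly_Mapping.keys g. scale (?d s) (eval \<mu> (?X(i := eval \<mu> (\<lambda>k. x (k + i - 1)) s)) t))"
    if "t \<in> Poly_Mapping.keys f" for t
    unfolding operation_def
    by (rule linear_sum_scale, rule linear_eval[OF \<mu>])
       (use f i that in \<open>auto simp: monomials_def\<close>)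
  then show ?thesis
    unfolding X unfolding operation_def[of scale \<mu> f]
    by (simp add: compose_at_def operation_sum eval_graft X scale_sum_right)
qed

lemma interpretation_hom:
  assumes "bilinear_product scale \<mu>"
  shows "interpretation_of scale \<mu> \<in> operad_hom free_operad (End_operad scale)"
  unfolding operad_hom_def mem_Collect_eq interpretation_of_def
proof (intro conjI allI ballI impI)
  fix n show "restrict (operation scale \<mu>) (arity free_operad n)
      \<in> arity free_operad n \<rightarrow>\<^sub>E arity (End_operad scale) n"
    using multilinear_operation[OF assms] by (auto simp del: free_operad_simps)
next
  fix n and f g :: "nat magma \<Rightarrow>\<^sub>0 'k"
  assume "f \<in> arity free_operad n" "g \<in> arity free_operad n"
  then show "restrict (operation scale \<mu>) (arity free_operad n) (opadd free_operad n f g) =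
    opadd (End_operad scale) n (restrict (operation scale \<mu>) (arity free_operad n) f)
      (restrict (operation scale \<mu>) (arity free_operad n) g)"
    using free_arity_add[of f n g] by (simp add: operation_add fun_eq_iff del: free_operad_simps(1))
next
  fix n c and f :: "nat magma \<Rightarrow>\<^sub>0 'k"
  assume "f \<in> arity free_operad n"
  then show "restrict (operation scale \<mu>) (arity free_operad n) (opscale free_operad n c f) =
    opscale (End_operad scale) n c (restrict (operation scale \<mu>) (arity free_operad n) f)"
    using free_arity_scale[of f n c] by (simp add: operation_scale fun_eq_iff del: free_operad_simps(1))
next
  fix n \<sigma> and f :: "nat magma \<Rightarrow>\<^sub>0 'k"
  assume "\<sigma> permutes {1..n}" "f \<in> arity free_operad n"
  then show "restrict (operation scale \<mu>) (arity free_operad n) (opact free_operad n \<sigma> f) =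
    opact (End_operad scale) n \<sigma> (restrict (operation scale \<mu>) (arity free_operad n) f)"
    using free_arity_relabel[of f n \<sigma>] by (simp add: operation_relabel fun_eq_iff del: free_operad_simps(1))
next
  fix n m i and f g :: "nat magma \<Rightarrow>\<^sub>0 'k"
  assume i: "i \<in> {1..n}" and f: "f \<in> arity free_operad n" and g: "g \<in> arity free_operad m"
  show "restrict (operation scale \<mu>) (arity free_operad (n + m - 1)) (opcomp free_operad n m i f g) =
    opcomp (End_operad scale) n m i (restrict (operation scale \<mu>) (arity free_operad n) f)
      (restrict (operation scale \<mu>) (arity free_operad m) g)"
    unfolding free_operad_simps(6) restrict_apply'[OF free_arity_compose_at[OF f g i]]
      restrict_apply'[OF f] restrict_apply'[OF g] End_operad_simps
    by (rule ext) (rule operation_compose_at[OF assms f i])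
next
  show "restrict (operation scale \<mu>) (arity free_operad 1) (opunit free_operad) = opunit (End_operad scale)"
    unfolding free_operad_simps(7) restrict_apply'[OF free_arity_unit] by (simp add: fun_eq_iff)
qed

definition hom_product :: "(nat \<Rightarrow> (nat magma \<Rightarrow>\<^sub>0 'k) \<Rightarrow> (nat \<Rightarrow> 'v) \<Rightarrow> 'v) \<Rightarrow> 'v \<Rightarrow> 'v \<Rightarrow> 'v"
  where "hom_product \<psi> a b = \<psi> 2 (monom (Gen 1 \<cdot> Gen 2)) (\<lambda>i. if i = 1 then a else b)"

lemma product_arity: "(monom (Gen 1 \<cdot> Gen 2) :: nat magma \<Rightarrow>\<^sub>0 'k) \<in> arity free_operad 2"
  by (auto simp: monom_def monomials_def)

lemma bilinear_hom_product:
  assumes \<psi>: "\<psi> \<in> operad_hom free_operad (End_operad scale)"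
  shows "bilinear_product scale (hom_product \<psi>)"
proof -
  have ml: "multilinear scale 2 (\<psi> 2 (monom (Gen 1 \<cdot> Gen 2)))"
    using operad_homD(2)[OF \<psi> product_arity] by simp
  have left: "hom_product \<psi> a b = \<psi> 2 (monom (Gen 1 \<cdot> Gen 2)) ((\<lambda>i. b)(1 := a))" for a b
    unfolding hom_product_def by (rule multilinear_cong[OF ml]) auto
  have right: "hom_product \<psi> a b = \<psi> 2 (monom (Gen 1 \<cdot> Gen 2)) ((\<lambda>i. a)(2 := b))" for a b
    unfolding hom_product_def by (rule multilinear_cong[OF ml]) auto
  have "Vector_Spaces.linear scale scale (\<lambda>b. hom_product \<psi> a b)" for a
    unfolding right by (rule multilinear_linear[OF ml]) simp
  moreover have "Vector_Spaces.linear scale scale (\<lambda>a. hom_product \<psi> a b)" for b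
    unfolding left by (rule multilinear_linear[OF ml]) simp
  ultimately show ?thesis
    unfolding bilinear_product_def by blast
qed

text \<open>
  This is where generation by the binary product enters: a tree \<open>s \<cdot> u\<close> whose leaves are in
  their natural order is \<open>((x\<^sub>1.x\<^sub>2) \<circ>\<^sub>2 u') \<circ>\<^sub>1 s\<close>, where \<open>u'\<close> is \<open>u\<close> with its leaves
  renumbered from 1. The factors have smaller arity.
\<close>

lemma hom_on_ordered_monomial:
  assumes \<psi>: "\<psi> \<in> operad_hom free_operad (End_operad scale)"
    and "leaves t = [1..<Suc n]"
  shows "\<psi> n (monom t) = (\<lambda>x. eval (hom_product \<psi>) x t)"
  using assms(2)
proof (induction n arbitrary: t rule: less_induct)
  case (less n)
  have ordered_arity: "(monom u :: nat magma \<Rightarrow>\<^sub>0 'k) \<in> arity free_operad k" if "leaves u = [1..<Suc k]" for u k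
    using that by (auto simp: monom_def monomials_def)
  show ?case
  proof (cases t)
    case (Gen a)
    with less.prems have "n = 1 \<and> a = 1"
      by (cases n) (auto simp: upt_rec split: if_splits)
    then show ?thesis
      using Gen operad_homD(7)[OF \<psi>] by simp
  next
    case (Mul s u)
    define p q where "p = length (leaves s)" and "q = length (leaves u)"
    define u' where "u' = map_magma (\<lambda>k. k - p) u"
    have pq: "n = p + q" "p > 0" "q > 0"
      using arg_cong[OF less.prems, of length] Mul by (auto simp: p_def q_def)
    have app: "leaves s @ leaves u = [1..<Suc n]"
      using less.prems Mul by simp
    have s: "leaves s = [1..<Suc p]"
      using arg_cong[OF app, of "take p"] pq by (simp add: p_def take_upt)
    have u: "leaves u = [Suc p..<Suc n]"
      using arg_cong[OF app, of "drop p"] pq by (simp add: p_def drop_upt)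
    have u': "leaves u' = [1..<Suc q]"
      unfolding u'_def leaves_map_magma u pq(1)
      by (rule nth_equalityI) (auto simp del: upt_Suc)
    have ml: "multilinear scale 2 (\<psi> 2 (monom (Gen 1 \<cdot> Gen 2)))"
      using operad_homD(2)[OF \<psi> product_arity] by simp
    have m2: "\<psi> 2 (monom (Gen 1 \<cdot> Gen 2)) x = hom_product \<psi> (x 1) (x 2)" for x
      unfolding hom_product_def
      by (rule multilinear_cong[OF ml]) (auto simp: numeral_2_eq_2 le_Suc_eq)
    let ?C = "compose_at q 2 (monom (Gen 1 \<cdot> Gen 2)) (monom u') :: nat magma \<Rightarrow>\<^sub>0 'k"
    have C: "?C \<in> arity free_operad (q + 1)"
      using free_arity_compose_at[OF product_arity ordered_arity[OF u'], of 2]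
      by (simp add: add.commute del: free_operad_simps(1))
    have "\<psi> (2 + q - 1) (opcomp free_operad 2 q 2 (monom (Gen 1 \<cdot> Gen 2)) (monom u')) =
        opcomp (End_operad scale) 2 q 2 (\<psi> 2 (monom (Gen 1 \<cdot> Gen 2))) (\<psi> q (monom u'))"
      by (rule operad_homD(6)[OF \<psi> _ product_arity ordered_arity[OF u']]) simp
    then have \<psi>C: "\<psi> (q + 1) ?C = (\<lambda>x. hom_product \<psi> (x 1) (eval (hom_product \<psi>) (\<lambda>k. x (k + 1)) u'))"
      using less.IH[OF _ u'] pq by (simp add: m2[unfolded One_nat_def])
    have "monom t = compose_at p 1 ?C (monom s)"
    proof -
      have "subst (\<lambda>j. if j < 1 then Gen j else if j = 1 then map_magma (\<lambda>k. k + 1 - 1) s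
          else Gen (j + p - 1)) (map_magma (\<lambda>k. k + 2 - 1) u') = u"
        unfolding u'_def subst_map_magma magma.map_comp
        by (rule subst_Gen) (use u in auto)
      then have "graft p 1 (Gen 1 \<cdot> map_magma (\<lambda>k. k + 2 - 1) u') s = s \<cdot> u"
        by (simp only: graft_def subst.simps) (simp add: magma.map_ident)
      moreover have "graft q 2 (Gen 1 \<cdot> Gen 2) u' = Gen 1 \<cdot> map_magma (\<lambda>k. k + 2 - 1) u'"
        by (simp add: graft_def)
      ultimately show ?thesis
        by (simp only: monom_def compose_at_single Mul mult_1)
    qed
    moreover have "\<psi> ((q + 1) + p - 1) (opcomp free_operad (q + 1) p 1 ?C (monom s)) =
        opcomp (End_operad scale) (q + 1) p 1 (\<psi> (q + 1) ?C) (\<psi> p (monom s))"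
      by (rule operad_homD(6)[OF \<psi> _ C ordered_arity[OF s]]) simp
    ultimately have "\<psi> n (monom t) = opcomp (End_operad scale) (q + 1) p 1 (\<psi> (q + 1) ?C) (\<psi> p (monom s))"
      using pq by (simp add: add.commute)
    also have "\<dots> = (\<lambda>x. eval (hom_product \<psi>) x t)"
    proof
      fix x
      let ?y = "\<lambda>j. if j < 1 then x j else if j = 1 then eval (hom_product \<psi>) (\<lambda>k. x (k + 1 - 1)) s
        else x (j + p - 1)"
      \<comment> \<open>the leaves of \<open>u\<close> are above \<open>p > 0\<close>, so the first two branches of \<open>?y\<close> are never reached here\<close>
      have "eval (hom_product \<psi>) (\<lambda>k. ?y (k + 1)) u' = eval (hom_product \<psi>) x u"
        unfolding u'_def eval_map_magma by (rule eval_cong) (use u in auto)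
      then show "opcomp (End_operad scale) (q + 1) p 1 (\<psi> (q + 1) ?C) (\<psi> p (monom s)) x =
          eval (hom_product \<psi>) x t"
        using less.IH[OF _ s] pq by (simp add: \<psi>C Mul del: One_nat_def)
    qed
    finally show ?thesis .
  qed
qed

text \<open>
  Reading the leaves from left to right gives the permutation that carries a tree with
  ordered leaves to the given one.
\<close>

lemma hom_on_monomial:
  assumes \<psi>: "\<psi> \<in> operad_hom free_operad (End_operad scale)" and t: "t \<in> monomials n"
  shows "\<psi> n (monom t) = (\<lambda>x. eval (hom_product \<psi>) x t)"
proof -
  define \<sigma> where "\<sigma> i = (if i \<in> {1..n} then leaves t ! (i - 1) else i)" for i
  have dt: "distinct (leaves t)" "set (leaves t) = {1..n}"
    using t by (auto simp: monomials_def)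
  then have len: "length (leaves t) = n"
    using distinct_card[OF dt(1)] by simp
  have im: "map \<sigma> [1..<Suc n] = leaves t"
    by (rule nth_equalityI) (use len in \<open>auto simp: \<sigma>_def simp del: upt_Suc\<close>)
  have "inj_on \<sigma> {1..n}"
    using dt(1) len by (auto simp: inj_on_def \<sigma>_def nth_eq_iff_index_eq)
  moreover have "\<sigma> ` {1..n} = {1..n}"
    using arg_cong[OF im, of set] dt(2) by (simp add: atLeastLessThanSuc_atLeastAtMost del: upt_Suc)
  ultimately have \<sigma>: "\<sigma> permutes {1..n}"
    by (intro bij_imp_permutes) (auto simp: bij_betw_def \<sigma>_def)
  define t0 where "t0 = map_magma (inv \<sigma>) t"
  have t0: "leaves t0 = [1..<Suc n]"
    unfolding t0_def leaves_map_magma im[symmetric] map_map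
    using permutes_inv_o(2)[OF \<sigma>] by (simp only: list.map_id0 id_apply)
  have t_eq: "t = map_magma \<sigma> t0"
    unfolding t0_def magma.map_comp permutes_inv_o(1)[OF \<sigma>] by (simp add: magma.map_id)
  have "monom t0 \<in> arity free_operad n"
    using t0 by (auto simp: monom_def monomials_def)
  then have "\<psi> n (opact free_operad n \<sigma> (monom t0)) = opact (End_operad scale) n \<sigma> (\<psi> n (monom t0))"
    by (rule operad_homD(5)[OF \<psi> \<sigma>])
  then show ?thesis
    unfolding hom_on_ordered_monomial[OF \<psi> t0]
    by (simp add: t_eq monom_def eval_map_magma)
qed

lemma hom_eq_operation:
  assumes \<psi>: "\<psi> \<in> operad_hom free_operad (End_operad scale)" and f: "f \<in> arity free_operad n"
  shows "\<psi> n f = operation scale (hom_product \<psi>) f"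
proof -
  interpret vector_space scale by (rule vs)
  have mon: "monom t \<in> arity free_operad n" if "t \<in> monomials n" for t
    using that by (simp add: monom_def)
  have single: "Poly_Mapping.single t c = opscale free_operad n c (monom t)" for t and c :: 'k
    by (simp add: monom_def)
  \<comment> \<open>morphisms preserve zero because they preserve multiplication by the scalar zero\<close>
  have zero: "\<psi> n 0 = (\<lambda>x. 0)"
  proof -
    have "\<psi> n (opscale free_operad n 0 0) = opscale (End_operad scale) n 0 (\<psi> n 0)"
      by (rule operad_homD(4)[OF \<psi>]) simp
    moreover have "opscale free_operad n 0 (0 :: nat magma \<Rightarrow>\<^sub>0 'k) = 0"
      by (rule poly_mapping_eqI) simp
    ultimately show ?thesis by simp
  qed
  have "\<psi> n (\<Sum>t\<in>A. Poly_Mapping.single t (c t)) =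
      operation scale (hom_product \<psi>) (\<Sum>t\<in>A. Poly_Mapping.single t (c t))"
    if "finite A" "A \<subseteq> monomials n" for A and c :: "nat magma \<Rightarrow> 'k"
    using that
  proof (induction A rule: finite_induct)
    case empty
    then show ?case by (simp add: zero fun_eq_iff)
  next
    case (insert t A)
    have 1: "Poly_Mapping.single t (c t) \<in> arity free_operad n"
      using insert.prems by simp
    have 2: "(\<Sum>t\<in>A. Poly_Mapping.single t (c t)) \<in> arity free_operad n"
      unfolding free_operad_simps by (intro keys_subset_sum) (use insert.prems in auto)
    have "\<psi> n (Poly_Mapping.single t (c t)) = (\<lambda>x. scale (c t) (eval (hom_product \<psi>) x t))"
      unfolding single using operad_homD(4)[OF \<psi> mon, of t "c t"] hom_on_monomial[OF \<psi>, of t n] insert.prems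
      by simp
    moreover have "\<psi> n (opadd free_operad n (Poly_Mapping.single t (c t)) (\<Sum>t\<in>A. Poly_Mapping.single t (c t)))
      = opadd (End_operad scale) n (\<psi> n (Poly_Mapping.single t (c t))) (\<psi> n (\<Sum>t\<in>A. Poly_Mapping.single t (c t)))"
      by (rule operad_homD(3)[OF \<psi> 1 2])
    ultimately show ?case
      using insert by (simp add: operation_add fun_eq_iff)
  qed
  from this[of "Poly_Mapping.keys f" "Poly_Mapping.lookup f"] show ?thesis
    using f by (simp add: sum_monomials)
qed

section \<open>Algebras over a quadratic operad\<close>

text \<open>
  The elements acting as zero form an ideal, because a multilinear operation vanishes as
  soon as one of its inputs does. Hence a product that satisfies the defining relations
  satisfies everything in the ideal generated by them.
\<close>

lemma operadic_ideal_kernel: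
  assumes \<mu>: "bilinear_product scale \<mu>"
  shows "operadic_ideal free_operad (\<lambda>n. {f \<in> arity free_operad n. \<forall>x. operation scale \<mu> f x = 0})"
    (is "operadic_ideal _ ?K")
proof -
  interpret vector_space scale by (rule vs)
  have "submodule free_operad n (?K n)" for n
    unfolding submodule_free_iff free_operad_simps(1)[symmetric]
    by (auto simp: operation_add operation_scale operation_relabel submoduleD(2)[OF submodule_arity]
        free_arity_add free_arity_scale free_arity_relabel simp del: free_operad_simps(1))
  moreover have "compose_at m i f g \<in> ?K (n + m - 1)"
    if i: "i \<in> {1..n}" and f: "f \<in> arity free_operad n" and g: "g \<in> arity free_operad m"
      and K: "f \<in> ?K n \<or> g \<in> ?K m" for n m i f g
  proof -
    have "operation scale \<mu> (compose_at m i f g) x = 0" for x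
      using K
    proof
      assume "f \<in> ?K n"
      then show ?thesis by (simp add: operation_compose_at[OF \<mu> f i])
    next
      assume "g \<in> ?K m"
      then have X: "(\<lambda>j. if j < i then x j
          else if j = i then operation scale \<mu> g (\<lambda>k. x (k + i - 1)) else x (j + m - 1)) =
          (\<lambda>j. if j < i then x j else x (j + m - 1))(i := 0)"
        by auto
      interpret L: Vector_Spaces.linear scale scale
        "\<lambda>v. operation scale \<mu> f ((\<lambda>j. if j < i then x j else x (j + m - 1))(i := v))"
        by (rule multilinear_linear[OF multilinear_operation[OF \<mu> f] i])
      show ?thesis
        unfolding operation_compose_at[OF \<mu> f i] X by (rule L.zero)
    qed
    then show ?thesis using free_arity_compose_at[OF f g i] by blast
  qed
  ultimately show ?thesis unfolding operadic_ideal_def free_operad_simps(6) by blast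
qed

text \<open>
  An algebra over \<open>\<F>(E)/\<R>\<close> is a structure over the free operad, hence a bilinear product,
  that kills \<open>\<R>\<close>; by \<open>operadic_ideal_kernel\<close> it is enough that the generators of \<open>R\<close> act as
  zero.
\<close>

theorem algebras_of_quadratic_operad:
  assumes G: "G \<subseteq> arity free_operad 3"
  shows "bij_betw (algebra_product (relations G))
    (algebra_structures (quadratic_operad (relations G)) scale)
    {\<mu>. bilinear_product scale \<mu> \<and> (\<forall>g\<in>G. \<forall>x. operation scale \<mu> g x = 0)}"
proof -
  let ?I = "relation_ideal (relations G)"
  let ?cl = "\<lambda>n. ideal_class free_operad ?I n"
  let ?pull = "\<lambda>\<phi> n. \<lambda>f\<in>arity free_operad n. \<phi> n (?cl n f)"
  have R: "relations G \<subseteq> arity free_operad 3"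
    by (rule relations_minimal[OF submodule_arity G])
  note ideal = operadic_ideal_relation_ideal[OF R]
  have prod: "algebra_product (relations G) \<phi> = hom_product (?pull \<phi>)" for \<phi> :: "nat \<Rightarrow> _ \<Rightarrow> _ \<Rightarrow> 'v"
    using product_arity by (intro ext) (simp add: algebra_product_def hom_product_def del: free_operad_simps)
  have hom: "?pull \<phi> \<in> operad_hom free_operad (End_operad scale)"
    if "\<phi> \<in> algebra_structures (quadratic_operad (relations G)) scale" for \<phi>
    using quotient_hom_pullback[OF ideal] that by (simp add: algebra_structures_def quadratic_operad_def)
  have val: "\<phi> n (?cl n f) = operation scale (algebra_product (relations G) \<phi>) f"
    if "\<phi> \<in> algebra_structures (quadratic_operad (relations G)) scale" "f \<in> arity free_operad n" for \<phi> n f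
    using hom_eq_operation[OF hom[OF that(1)] that(2)] that(2) by (simp add: prod del: free_operad_simps)
  show ?thesis
  proof (rule bij_betw_imageI)
    show "inj_on (algebra_product (relations G)) (algebra_structures (quadratic_operad (relations G)) scale)"
    proof (rule inj_onI, rule ext)
      fix \<phi> \<phi>' n
      assume \<phi>: "\<phi> \<in> algebra_structures (quadratic_operad (relations G)) scale"
        and \<phi>': "\<phi>' \<in> algebra_structures (quadratic_operad (relations G)) scale"
        and eq: "algebra_product (relations G) \<phi> = algebra_product (relations G) \<phi>'"
      have ext: "\<phi> n \<in> extensional (?cl n ` arity free_operad n)" "\<phi>' n \<in> extensional (?cl n ` arity free_operad n)"
        using \<phi> \<phi>' unfolding algebra_structures_def quadratic_operad_def
        by (auto dest: operad_homD(1)[where n = n] simp: quotient_arity[OF ideal] simp del: free_operad_simps)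
      show "\<phi> n = \<phi>' n"
        by (rule extensionalityI[OF ext]) (use val[OF \<phi>] val[OF \<phi>'] eq in auto)
    qed
  next
    show "algebra_product (relations G) ` algebra_structures (quadratic_operad (relations G)) scale =
      {\<mu>. bilinear_product scale \<mu> \<and> (\<forall>g\<in>G. \<forall>x. operation scale \<mu> g x = 0)}"
    proof (intro equalityI subsetI)
      fix \<mu> assume "\<mu> \<in> algebra_product (relations G) ` algebra_structures (quadratic_operad (relations G)) scale"
      then obtain \<phi> where \<phi>: "\<phi> \<in> algebra_structures (quadratic_operad (relations G)) scale"
        and \<mu>: "\<mu> = algebra_product (relations G) \<phi>" by blast
      have "operation scale \<mu> g x = 0" if "g \<in> G" for g x
      proof -
        have gI: "g - 0 \<in> ?I 3"
          using that relations_superset relation_ideal_superset by fastforce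
        have cl: "?cl 3 g = ?cl 3 0"
          using gI by (simp only: ideal_class_eq_iff[OF ideal])
        have "operation scale \<mu> g = \<phi> 3 (?cl 3 g)"
          unfolding \<mu> by (rule val[OF \<phi>, symmetric]) (use that G in blast)
        also have "\<dots> = \<phi> 3 (?cl 3 0)"
          by (simp only: cl)
        also have "\<dots> = operation scale \<mu> 0"
          unfolding \<mu> by (rule val[OF \<phi>]) simp
        finally show ?thesis by simp
      qed
      moreover have "bilinear_product scale \<mu>"
        unfolding \<mu> prod by (rule bilinear_hom_product[OF hom[OF \<phi>]])
      ultimately show "\<mu> \<in> {\<mu>. bilinear_product scale \<mu> \<and> (\<forall>g\<in>G. \<forall>x. operation scale \<mu> g x = 0)}"
        by blast
    next
      fix \<mu> assume "\<mu> \<in> {\<mu>. bilinear_product scale \<mu> \<and> (\<forall>g\<in>G. \<forall>x. operation scale \<mu> g x = 0)}"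
      then have \<mu>: "bilinear_product scale \<mu>" and G0: "\<And>g x. g \<in> G \<Longrightarrow> operation scale \<mu> g x = 0"
        by blast+
      let ?K = "\<lambda>n. {f \<in> arity free_operad n. \<forall>x. operation scale \<mu> f x = 0}"
      note K = operadic_ideal_kernel[OF \<mu>]
      have "relations G \<subseteq> ?K 3"
      proof (rule relations_minimal)
        show "submodule free_operad 3 (?K 3)" using K unfolding operadic_ideal_def by blast
        show "G \<subseteq> ?K 3" using G G0 by blast
      qed
      then have IK: "?I n \<subseteq> ?K n" for n
        by (rule relation_ideal_minimal[OF K])
      have kill: "interpretation_of scale \<mu> n f = interpretation_of scale \<mu> n g"
        if "f \<in> arity free_operad n" "g \<in> arity free_operad n" "f - g \<in> ?I n" for n f g
      proof -
        have "operation scale \<mu> f x - operation scale \<mu> g x = 0" for x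
          using IK that(3) by (auto simp: operation_diff[symmetric])
        then show ?thesis
          using that(1,2) by (simp add: interpretation_of_def fun_eq_iff del: free_operad_simps)
      qed
      obtain \<phi> where \<phi>: "\<phi> \<in> operad_hom (quotient_operad free_operad ?I) (End_operad scale)"
        and v: "\<And>n f. f \<in> arity free_operad n \<Longrightarrow> \<phi> n (?cl n f) = interpretation_of scale \<mu> n f"
        using quotient_hom_lift[OF ideal interpretation_hom[OF \<mu>] kill] by blast
      have "algebra_product (relations G) \<phi> = \<mu>"
        using v[OF product_arity] product_arity
        by (intro ext) (simp add: algebra_product_def interpretation_of_def del: free_operad_simps)
      then show "\<mu> \<in> algebra_product (relations G) ` algebra_structures (quadratic_operad (relations G)) scale"
        using \<phi> by (auto simp: algebra_structures_def quadratic_operad_def)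
    qed
  qed
qed

end

section \<open>Orthogonals of signed sums of associators\<close>

text \<open>
  The orbits of the two bracketings of three letters, indexed by the permutations of
  \<open>{1..3}\<close>, so that the action becomes left multiplication of the index.
\<close>

definition rtree :: "(nat \<Rightarrow> nat) \<Rightarrow> nat magma"
  where "rtree \<sigma> = Gen (\<sigma> 1) \<cdot> (Gen (\<sigma> 2) \<cdot> Gen (\<sigma> 3))"

definition ltree :: "(nat \<Rightarrow> nat) \<Rightarrow> nat magma"
  where "ltree \<sigma> = (Gen (\<sigma> 1) \<cdot> Gen (\<sigma> 2)) \<cdot> Gen (\<sigma> 3)"

abbreviation perms3 :: "(nat \<Rightarrow> nat) set"
  where "perms3 \<equiv> {\<sigma>. \<sigma> permutes {1..3}}"

lemma atLeastAtMost_1_3: "{1..3::nat} = {1, 2, 3}"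
  by auto

lemma map_magma_tree [simp]:
  "map_magma \<sigma> (rtree \<tau>) = rtree (\<sigma> \<circ> \<tau>)"
  "map_magma \<sigma> (ltree \<tau>) = ltree (\<sigma> \<circ> \<tau>)"
  by (simp_all add: rtree_def ltree_def)

lemma rtree_neq_ltree [simp]: "rtree \<sigma> \<noteq> ltree \<tau>" "ltree \<sigma> \<noteq> rtree \<tau>"
  by (simp_all add: rtree_def ltree_def)

lemma perms3_eqI:
  assumes "\<sigma> \<in> perms3" "\<tau> \<in> perms3" "\<sigma> 1 = \<tau> 1" "\<sigma> 2 = \<tau> 2" "\<sigma> 3 = \<tau> 3"
  shows "\<sigma> = \<tau>"
proof
  fix i show "\<sigma> i = \<tau> i"
  proof (cases "i \<in> {1..3}")
    case True then show ?thesis using assms unfolding atLeastAtMost_1_3 by auto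
  next
    case False then show ?thesis using assms by (simp add: permutes_not_in)
  qed
qed

lemma rtree_inj: "\<sigma> \<in> perms3 \<Longrightarrow> \<tau> \<in> perms3 \<Longrightarrow> rtree \<sigma> = rtree \<tau> \<longleftrightarrow> \<sigma> = \<tau>"
  using perms3_eqI by (auto simp: rtree_def)

lemma ltree_inj: "\<sigma> \<in> perms3 \<Longrightarrow> \<tau> \<in> perms3 \<Longrightarrow> ltree \<sigma> = ltree \<tau> \<longleftrightarrow> \<sigma> = \<tau>"
  using perms3_eqI by (auto simp: ltree_def)

lemma perms3_as_update:
  assumes "\<sigma> \<in> perms3"
  shows "id(1 := \<sigma> 1, 2 := \<sigma> 2, 3 := \<sigma> 3) = \<sigma>"
proof
  fix i show "(id(1 := \<sigma> 1, 2 := \<sigma> 2, 3 := \<sigma> 3)) i = \<sigma> i"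
    using assms permutes_not_in[of \<sigma> "{1..3}" i] by auto
qed

lemma form_weight_tree:
  assumes "\<sigma> \<in> perms3"
  shows "form_weight (rtree \<sigma>) = sign \<sigma>" "form_weight (ltree \<sigma>) = - sign \<sigma>"
  using perms3_as_update[OF assms] by (simp_all add: rtree_def ltree_def sgn3_def)

lemma tree_monomials:
  assumes "\<sigma> \<in> perms3"
  shows "rtree \<sigma> \<in> monomials 3" "ltree \<sigma> \<in> monomials 3"
proof -
  have "\<sigma> ` {1..3} = {1..3}" and "inj \<sigma>"
    using assms permutes_image permutes_inj by blast+
  then have "{\<sigma> 1, \<sigma> 2, \<sigma> 3} = {1..3}" "inj \<sigma>"
    unfolding atLeastAtMost_1_3 by simp_all
  then show "rtree \<sigma> \<in> monomials 3" "ltree \<sigma> \<in> monomials 3"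
    by (auto simp: rtree_def ltree_def monomials_def inj_eq)
qed

lemma monomials_3: "monomials 3 = rtree ` perms3 \<union> ltree ` perms3"
proof (intro equalityI subsetI)
  fix t assume "t \<in> monomials 3"
  then have d: "distinct (leaves t)" and s: "set (leaves t) = {1..3}"
    by (auto simp: monomials_def)
  have len: "length (leaves t) = 3"
    using distinct_card[OF d] s by simp
  have pos: "length (leaves u) > 0" for u :: "nat magma" by simp
  obtain i j k where ijk: "t = Gen i \<cdot> (Gen j \<cdot> Gen k) \<or> t = (Gen i \<cdot> Gen j) \<cdot> Gen k"
  proof -
    have 1: "\<exists>i. u = Gen i" if "length (leaves u) = 1" for u :: "nat magma"
    proof (cases u)
      case (Mul s w)
      then have "length (leaves s) + length (leaves w) = 1" using that by simp
      then have False using pos[of s] pos[of w] by linarith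
      then show ?thesis ..
    qed simp
    have 2: "\<exists>i j. u = Gen i \<cdot> Gen j" if "length (leaves u) = 2" for u :: "nat magma"
    proof (cases u)
      case (Mul s w)
      then have "length (leaves s) + length (leaves w) = 2" using that by simp
      then have "length (leaves s) = 1 \<and> length (leaves w) = 1"
        using pos[of s] pos[of w] by linarith
      then show ?thesis using Mul 1[of s] 1[of w] by blast
    qed (use that in simp)
    show ?thesis
    proof (cases t)
      case (Mul s w)
      then have "length (leaves s) + length (leaves w) = 3" using len by simp
      then have "length (leaves s) = 1 \<and> length (leaves w) = 2 \<or> length (leaves s) = 2 \<and> length (leaves w) = 1"
        using pos[of s] pos[of w] by linarith
      then show ?thesis using Mul 1[of s] 1[of w] 2[of s] 2[of w] that by blast
    qed (use len in simp)
  qed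
  define \<sigma> where "\<sigma> = id(1 := i, 2 := j, 3 := k)"
  have "leaves t = [i, j, k]" using ijk by auto
  then have \<sigma>: "distinct [i, j, k]" "{i, j, k} = {1..3}" using d s by auto
  have "bij_betw \<sigma> {1, 2, 3} {1, 2, 3}"
    using \<sigma> unfolding atLeastAtMost_1_3 by (auto simp: bij_betw_def \<sigma>_def inj_on_def)
  then have "\<sigma> \<in> perms3"
    unfolding atLeastAtMost_1_3 mem_Collect_eq by (rule bij_imp_permutes) (auto simp: \<sigma>_def)
  moreover have "t = rtree \<sigma> \<or> t = ltree \<sigma>"
    using ijk by (simp add: rtree_def ltree_def \<sigma>_def)
  ultimately show "t \<in> rtree ` perms3 \<union> ltree ` perms3" by blast
qed (use tree_monomials in auto)

lemma finite_perms3: "finite perms3"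
  by (rule finite_permutations) simp

lemma tree_expansion:
  fixes v :: "nat magma \<Rightarrow>\<^sub>0 'k::field"
  assumes "v \<in> arity free_operad 3"
  shows "v = (\<Sum>\<sigma>\<in>perms3. Poly_Mapping.single (rtree \<sigma>) (Poly_Mapping.lookup v (rtree \<sigma>)) +
    Poly_Mapping.single (ltree \<sigma>) (Poly_Mapping.lookup v (ltree \<sigma>)))"
proof -
  let ?s = "\<lambda>t. Poly_Mapping.single t (Poly_Mapping.lookup v t)"
  have inj: "inj_on rtree perms3" "inj_on ltree perms3"
    by (auto simp: inj_on_def rtree_inj ltree_inj simp del: mem_Collect_eq)
  have "v = sum ?s (Poly_Mapping.keys v)"
    by (simp add: sum_monomials)
  also have "\<dots> = sum ?s (rtree ` perms3 \<union> ltree ` perms3)"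
    by (rule sum.mono_neutral_left) (use assms finite_perms3 in \<open>auto simp: monomials_3 in_keys_iff\<close>)
  also have "\<dots> = sum ?s (rtree ` perms3) + sum ?s (ltree ` perms3)"
    by (rule sum.union_disjoint) (use finite_perms3 in auto)
  finally show ?thesis
    unfolding sum.reindex[OF inj(1)] sum.reindex[OF inj(2)] o_def sum.distrib .
qed

text \<open>
  The relation of the \<open>H\<close>-associative algebras: the sum over \<open>h\<close> in \<open>H\<close> of \<open>sgn h\<close> times
  \<open>x.(y.z) - (x.y).z\<close> with its arguments permuted by \<open>h\<close>. The subgroups generated by \<open>(1 2)\<close>,
  \<open>(1 3)\<close> and a 3-cycle give the three operads of the theorem.
\<close>

definition signed_associator_sum :: "(nat \<Rightarrow> nat) set \<Rightarrow> (nat magma \<Rightarrow>\<^sub>0 'k::field)"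
  where "signed_associator_sum H = (\<Sum>h\<in>H.
    Poly_Mapping.single (rtree h) (of_int (sign h)) - Poly_Mapping.single (ltree h) (of_int (sign h)))"

text \<open>
  The coordinates of \<open>v\<close> that matter for the duality: the image of \<open>v\<close> in the
  associative quotient, where both bracketings of a word become equal.
\<close>

definition coeff_sum :: "(nat magma \<Rightarrow>\<^sub>0 'k::field) \<Rightarrow> (nat \<Rightarrow> nat) \<Rightarrow> 'k"
  where "coeff_sum v \<sigma> = Poly_Mapping.lookup v (rtree \<sigma>) + Poly_Mapping.lookup v (ltree \<sigma>)"

lemma pairing_zero [simp]: "pairing 0 v = 0"
  by (simp add: pairing_def)

lemma pairing_single [simp]:
  "pairing (Poly_Mapping.single t c) v = of_int (form_weight t) * c * Poly_Mapping.lookup v t"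
  by (simp add: pairing_def)

lemma pairing_add: "pairing (u + u') v = pairing u v + pairing u' v"
  unfolding pairing_def by (rule setsum_keys_plus_distrib) (simp_all add: algebra_simps)

lemma pairing_diff: "pairing (u - u') v = pairing u v - pairing u' v"
  using pairing_add[of "u - u'" u' v] by simp

lemma pairing_sum: "pairing (sum F X) v = (\<Sum>x\<in>X. pairing (F x) v)"
  by (induction X rule: infinite_finite_induct) (simp_all add: pairing_add)

lemma pairing_scale: "pairing (Poly_Mapping.map ((*) c) u) v = c * pairing u v"
proof -
  have "pairing (Poly_Mapping.map ((*) c) u) v =
      (\<Sum>t\<in>Poly_Mapping.keys u. of_int (form_weight t) * (c * Poly_Mapping.lookup u t) * Poly_Mapping.lookup v t)"
    unfolding pairing_def by (rule sum.mono_neutral_cong_left) (auto simp: in_keys_iff)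
  then show ?thesis by (simp add: pairing_def sum_distrib_left algebra_simps)
qed

lemma lookup_relabel:
  assumes "\<sigma> permutes {1..n}"
  shows "Poly_Mapping.lookup (relabel \<sigma> v) (map_magma \<sigma> t) = Poly_Mapping.lookup v t"
proof -
  have inj: "map_magma \<sigma> s = map_magma \<sigma> t \<longleftrightarrow> s = t" for s
    using magma.inj_map[OF permutes_inj[OF assms]] by (simp add: inj_eq)
  show ?thesis
    by (simp add: relabel_def lookup_sum lookup_single when_def inj in_keys_iff)
qed

lemma coeff_sum_relabel:
  assumes "\<tau> permutes {1..3}"
  shows "coeff_sum (relabel \<tau> v) \<sigma> = coeff_sum v (inv \<tau> \<circ> \<sigma>)"
proof -
  have "\<sigma> = \<tau> \<circ> (inv \<tau> \<circ> \<sigma>)"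
    using permutes_inv_o(1)[OF assms] by (simp add: o_assoc)
  then show ?thesis
    using lookup_relabel[OF assms, of v "rtree (inv \<tau> \<circ> \<sigma>)"]
      lookup_relabel[OF assms, of v "ltree (inv \<tau> \<circ> \<sigma>)"]
    by (simp add: coeff_sum_def)
qed

lemma perms3_permutation: "\<sigma> \<in> perms3 \<Longrightarrow> permutation \<sigma>"
  using permutation_permutes by blast

lemma signed_associator_sum_arity:
  "H \<subseteq> perms3 \<Longrightarrow> signed_associator_sum H \<in> arity free_operad 3"
  unfolding signed_associator_sum_def free_operad_simps
  by (intro keys_subset_sum keys_diff_subset) (use tree_monomials in \<open>auto\<close>)

text \<open>
  The opposite signs of the two bracketings in the pairing cancel against the opposite
  signs in the associator, and \<open>sgn (\<sigma> h) sgn h = sgn \<sigma>\<close> takes all remaining signs out of the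
  sum. Orthogonality to a signed sum thus becomes the vanishing of an unsigned sum over a coset.
\<close>

lemma pairing_signed_associator_sum:
  assumes H: "H \<subseteq> perms3" and \<sigma>: "\<sigma> \<in> perms3"
  shows "pairing (relabel \<sigma> (signed_associator_sum H)) v =
    of_int (sign \<sigma>) * (\<Sum>h\<in>H. coeff_sum v (\<sigma> \<circ> h))"
proof -
  have "pairing (relabel \<sigma> (signed_associator_sum H)) v = (\<Sum>h\<in>H.
     of_int (form_weight (rtree (\<sigma> \<circ> h))) * of_int (sign h) * Poly_Mapping.lookup v (rtree (\<sigma> \<circ> h)) -
     of_int (form_weight (ltree (\<sigma> \<circ> h))) * of_int (sign h) * Poly_Mapping.lookup v (ltree (\<sigma> \<circ> h)))"
    by (simp add: signed_associator_sum_def relabel_sum relabel_diff pairing_sum pairing_diff)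
  also have "\<dots> = (\<Sum>h\<in>H. of_int (sign \<sigma>) * coeff_sum v (\<sigma> \<circ> h))"
  proof (rule sum.cong[OF refl])
    fix h assume h: "h \<in> H"
    then have p: "\<sigma> \<circ> h \<in> perms3"
      using H \<sigma> permutes_compose by blast
    have s: "sign (\<sigma> \<circ> h) * sign h = sign \<sigma>"
      using H h \<sigma> by (simp add: sign_compose perms3_permutation subset_iff mult.assoc)
    show "of_int (form_weight (rtree (\<sigma> \<circ> h))) * of_int (sign h) * Poly_Mapping.lookup v (rtree (\<sigma> \<circ> h)) -
       of_int (form_weight (ltree (\<sigma> \<circ> h))) * of_int (sign h) * Poly_Mapping.lookup v (ltree (\<sigma> \<circ> h)) =
       of_int (sign \<sigma>) * coeff_sum v (\<sigma> \<circ> h)"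
      unfolding form_weight_tree[OF p] s[symmetric] by (simp add: coeff_sum_def algebra_simps)
  qed
  finally show ?thesis by (simp add: sum_distrib_left)
qed

text \<open>
  Orthogonality to a submodule can be tested on the orbit of a generator, because the
  elements all of whose translates are orthogonal to \<open>v\<close> form a submodule.
\<close>

lemma orth_signed_associator_sum:
  assumes H: "H \<subseteq> perms3"
  shows "orth (relations {signed_associator_sum H :: nat magma \<Rightarrow>\<^sub>0 'k::field}) =
    {v \<in> arity free_operad 3. \<forall>\<sigma>\<in>perms3. (\<Sum>h\<in>H. coeff_sum v (\<sigma> \<circ> h)) = 0}" (is "_ = ?O")
proof (intro equalityI subsetI)
  fix v :: "nat magma \<Rightarrow>\<^sub>0 'k" assume v: "v \<in> orth (relations {signed_associator_sum H})"
  have "(\<Sum>h\<in>H. coeff_sum v (\<sigma> \<circ> h)) = 0" if \<sigma>: "\<sigma> \<in> perms3" for \<sigma>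
  proof -
    have "relabel \<sigma> (signed_associator_sum H :: nat magma \<Rightarrow>\<^sub>0 'k) \<in> relations {signed_associator_sum H}"
      by (rule submoduleD(5)[OF submodule_relations])
         (use \<sigma> relations_superset signed_associator_sum_arity[OF H] in blast)+
    then have "pairing (relabel \<sigma> (signed_associator_sum H)) v = 0"
      using v by (simp add: orth_def)
    moreover have "of_int (sign \<sigma>) \<noteq> (0 :: 'k)"
      by (cases \<sigma> rule: sign_cases) simp_all
    ultimately show ?thesis
      by (simp add: pairing_signed_associator_sum[OF H \<sigma>])
  qed
  then show "v \<in> ?O" using v by (simp add: orth_def)
next
  fix v :: "nat magma \<Rightarrow>\<^sub>0 'k" assume v: "v \<in> ?O"
  let ?M = "{u \<in> arity free_operad 3. \<forall>\<sigma>\<in>perms3. pairing (relabel \<sigma> u) v = 0}"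
  have comp: "relabel \<sigma> (relabel \<tau> u) = relabel (\<sigma> \<circ> \<tau>) u" for \<sigma> \<tau> and u :: "nat magma \<Rightarrow>\<^sub>0 'k"
    unfolding relabel_def[of \<tau> u] relabel_def[of "\<sigma> \<circ> \<tau>" u]
    by (simp add: relabel_sum magma.map_comp)
  have sc: "relabel \<sigma> (Poly_Mapping.map ((*) c) u) = Poly_Mapping.map ((*) c) (relabel \<sigma> u)"
    for \<sigma> c and u :: "nat magma \<Rightarrow>\<^sub>0 'k"
  proof -
    have "relabel \<sigma> (Poly_Mapping.map ((*) c) u) =
        (\<Sum>t\<in>Poly_Mapping.keys u. Poly_Mapping.single (map_magma \<sigma> t) (c * Poly_Mapping.lookup u t))"
      unfolding relabel_def by (rule sum.mono_neutral_cong_left) (auto simp: in_keys_iff)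
    also have "\<dots> = Poly_Mapping.map ((*) c) (relabel \<sigma> u)"
      by (rule poly_mapping_eqI)
         (simp add: relabel_def lookup_sum lookup_single when_def sum_distrib_left if_distrib cong: if_cong)
    finally show ?thesis .
  qed
  have "submodule free_operad 3 ?M"
    unfolding submodule_free_iff free_operad_simps(1)[symmetric]
    by (auto simp: relabel_add pairing_add sc pairing_scale comp permutes_compose
        submoduleD(2)[OF submodule_arity]
        free_arity_add free_arity_scale free_arity_relabel simp del: free_operad_simps(1))
  moreover have "signed_associator_sum H \<in> ?M"
    using v signed_associator_sum_arity[OF H] by (simp add: pairing_signed_associator_sum[OF H])
  ultimately have R: "relations {signed_associator_sum H} \<subseteq> ?M"
    by (intro relations_minimal) (simp_all only: insert_subset empty_subsetI simp_thms)
  have "pairing u v = 0" if "u \<in> relations {signed_associator_sum H}" for u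
  proof -
    have "relabel id u = u"
      by (simp add: relabel_def magma.map_id sum_monomials)
    moreover have "pairing (relabel id u) v = 0"
      using R that permutes_id[of "{1..3::nat}"] by blast
    ultimately show ?thesis by simp
  qed
  then show "v \<in> orth (relations {signed_associator_sum H})"
    using v by (simp add: orth_def)
qed

text \<open>
  The relations saying that the product is associative and that a product of three
  factors is invariant under permutations in \<open>H\<close>.
\<close>

definition subgroup_relations :: "(nat \<Rightarrow> nat) set \<Rightarrow> (nat magma \<Rightarrow>\<^sub>0 'k::field) set"
  where "subgroup_relations H =
    insert (monom (rtree id) - monom (ltree id)) ((\<lambda>h. monom (ltree id) - monom (ltree h)) ` H)"

lemma subgroup_relations_arity:
  assumes "H \<subseteq> perms3"
  shows "subgroup_relations H \<subseteq> arity free_operad 3"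
proof -
  have "monom t \<in> arity free_operad 3" if "t \<in> monomials 3" for t
    using that by (simp add: monom_def)
  then have "monom s - monom t \<in> arity free_operad 3" if "s \<in> monomials 3" "t \<in> monomials 3" for s t
    using that submodule_diff[OF submodule_arity] by blast
  then show ?thesis
    using assms tree_monomials permutes_id unfolding subgroup_relations_def by blast
qed

locale perm_subgroup =
  fixes H :: "(nat \<Rightarrow> nat) set"
  assumes subset: "H \<subseteq> perms3"
    and id_mem: "id \<in> H"
    and comp_mem: "g \<in> H \<Longrightarrow> h \<in> H \<Longrightarrow> g \<circ> h \<in> H"
    and inv_mem: "h \<in> H \<Longrightarrow> inv h \<in> H"
begin

lemma finite: "finite H"
  using subset finite_perms3 by (rule finite_subset)

text \<open>
  The equation \<open>\<sigma> h = \<tau>\<close> has exactly one solution \<open>h\<close>, so the sum only asks whether it lies in \<open>H\<close>.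
\<close>

lemma sum_coset:
  assumes "\<sigma> \<in> perms3" "\<tau> \<in> perms3"
  shows "(\<Sum>h\<in>H. if \<sigma> \<circ> h = \<tau> then 1 else 0) = (if inv \<sigma> \<circ> \<tau> \<in> H then 1 else (0::'k::field))"
proof -
  have "\<sigma> \<circ> h = \<tau> \<longleftrightarrow> h = inv \<sigma> \<circ> \<tau>" for h
    using permutes_inv_o[of \<sigma> "{1..3}"] assms(1) by (metis (no_types, lifting) comp_assoc comp_id id_comp mem_Collect_eq)
  then show ?thesis using finite by (simp add: sum.delta)
qed

lemma inv_comp_mem_iff:
  assumes "h \<in> H"
  shows "inv \<sigma> \<circ> h \<in> H \<longleftrightarrow> inv \<sigma> \<in> H" 
proof
  assume "inv \<sigma> \<circ> h \<in> H"
  then have "(inv \<sigma> \<circ> h) \<circ> inv h \<in> H"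
    using assms comp_mem inv_mem by blast
  then show "inv \<sigma> \<in> H"
    using permutes_inv_o(1)[of h "{1..3}"] subset assms by (auto simp: comp_assoc)
qed (use assms comp_mem in blast)

lemma sum_inverse: "(\<Sum>h\<in>H. F (inv h)) = sum F H"
proof (rule sum.reindex_bij_witness[where i = inv and j = inv])
  fix h assume "h \<in> H"
  then have "inv (inv h) = h"
    using subset permutes_inv_inv by blast
  then show "inv (inv h) = h" "inv (inv h) = h" "F (inv h) = F (inv h)" by auto
qed (use inv_mem in auto)

text \<open>
  By \<open>orth_signed_associator_sum\<close> the left-hand side consists of the \<open>v\<close> whose image in the
  associative quotient has coefficient sum zero on every left coset of \<open>H\<close>. The relations on the right
  clearly have this property. Conversely, modulo associativity \<open>v\<close> equals
  \<open>\<Sum>\<sigma>. a\<^sub>\<sigma> l\<^sub>\<sigma>\<close> with \<open>l\<^sub>\<sigma>\<close> the left-bracketed words, and modulo \<open>H\<close>-invariance each \<open>l\<^sub>\<sigma>\<close> may be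
  replaced by its average over the coset \<open>\<sigma> H\<close>; the averaged coefficients vanish. The
  averaging divides by the order of \<open>H\<close>, hence the characteristic-zero hypothesis.
\<close>

theorem orth_eq:
  "orth (relations {signed_associator_sum H}) =
    relations (subgroup_relations H :: (nat magma \<Rightarrow>\<^sub>0 'k::field_char_0) set)"
proof
  have sub: "submodule free_operad 3 (orth (relations {signed_associator_sum H :: nat magma \<Rightarrow>\<^sub>0 'k}))"
  proof -
    have "(\<Sum>h\<in>H. coeff_sum (relabel \<tau> v) (\<sigma> \<circ> h)) = 0"
      if "\<tau> permutes {1..3}" "\<sigma> permutes {1..3}" "\<forall>\<sigma>\<in>perms3. (\<Sum>h\<in>H. coeff_sum v (\<sigma> \<circ> h)) = 0"
      for \<sigma> \<tau> and v :: "nat magma \<Rightarrow>\<^sub>0 'k"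
      using that(3)[rule_format, of "inv \<tau> \<circ> \<sigma>"] permutes_compose[OF that(2) permutes_inv[OF that(1)]]
      by (simp add: coeff_sum_relabel[OF that(1)] comp_assoc)
    then show ?thesis
      unfolding orth_signed_associator_sum[OF subset] submodule_free_iff free_operad_simps(1)[symmetric]
      by (auto simp: submoduleD(2)[OF submodule_arity] free_arity_add free_arity_scale free_arity_relabel
          coeff_sum_def lookup_add sum.distrib distrib_left[symmetric] sum_distrib_left[symmetric] algebra_simps
          simp del: free_operad_simps(1))
  qed
  show "relations (subgroup_relations H) \<subseteq> orth (relations {signed_associator_sum H :: nat magma \<Rightarrow>\<^sub>0 'k})"
  proof (rule relations_minimal[OF sub], rule subsetI)
    fix g :: "nat magma \<Rightarrow>\<^sub>0 'k" assume g: "g \<in> subgroup_relations H"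
    have L: "coeff_sum (monom (ltree \<tau>)) \<sigma> = (if \<sigma> = \<tau> then 1 else (0::'k))"
      and R: "coeff_sum (monom (rtree \<tau>)) \<sigma> = (if \<sigma> = \<tau> then 1 else (0::'k))"
      if "\<sigma> \<in> perms3" "\<tau> \<in> perms3" for \<sigma> \<tau>
      using that by (auto simp: coeff_sum_def monom_def lookup_single when_def rtree_inj ltree_inj simp del: mem_Collect_eq)
    have D: "coeff_sum (u - v) \<sigma> = coeff_sum u \<sigma> - coeff_sum v \<sigma>" for u v :: "nat magma \<Rightarrow>\<^sub>0 'k" and \<sigma>
      by (simp add: coeff_sum_def lookup_minus)
    have "(\<Sum>h\<in>H. coeff_sum g (\<sigma> \<circ> h)) = 0" if \<sigma>: "\<sigma> \<in> perms3" for \<sigma>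
    proof -
      have p: "\<sigma> \<circ> h \<in> perms3" if "h \<in> H" for h
        using \<sigma> that subset permutes_compose by blast
      have i: "id \<in> perms3" using permutes_id by simp
      consider "g = monom (rtree id) - monom (ltree id)"
        | k where "k \<in> H" "g = monom (ltree id) - monom (ltree k)"
        using g unfolding subgroup_relations_def by blast
      then show ?thesis
      proof cases
        case 1
        then show ?thesis using p i by (simp add: D L R del: mem_Collect_eq)
      next
        case (2 k)
        have k: "k \<in> perms3" using 2 subset by blast
        have "(\<Sum>h\<in>H. coeff_sum g (\<sigma> \<circ> h)) =
          (\<Sum>h\<in>H. if \<sigma> \<circ> h = id then 1 else 0) - (\<Sum>h\<in>H. if \<sigma> \<circ> h = k then 1 else 0)"
          unfolding 2(2) D sum_subtractf
          by (intro arg_cong2[where f = "(-)"] sum.cong refl L p i k)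
        then show ?thesis
          using inv_comp_mem_iff[OF 2(1), of \<sigma>] by (simp add: sum_coset[OF \<sigma> i] sum_coset[OF \<sigma> k])
      qed
    qed
    then show "g \<in> orth (relations {signed_associator_sum H})"
      unfolding orth_signed_associator_sum[OF subset]
      using g subgroup_relations_arity[OF subset] by blast
  qed
next
  show "orth (relations {signed_associator_sum H}) \<subseteq> relations (subgroup_relations H :: (nat magma \<Rightarrow>\<^sub>0 'k) set)"
  proof
    fix v :: "nat magma \<Rightarrow>\<^sub>0 'k" assume "v \<in> orth (relations {signed_associator_sum H})"
    then have v: "v \<in> arity free_operad 3"
      and v0: "\<And>\<sigma>. \<sigma> \<in> perms3 \<Longrightarrow> (\<Sum>h\<in>H. coeff_sum v (\<sigma> \<circ> h)) = 0"
      unfolding orth_signed_associator_sum[OF subset] by blast+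
    let ?M = "relations (subgroup_relations H :: (nat magma \<Rightarrow>\<^sub>0 'k) set)"
    let ?r = "\<lambda>\<sigma>. Poly_Mapping.lookup v (rtree \<sigma>)" and ?a = "coeff_sum v"
    let ?S = "\<lambda>t c. Poly_Mapping.single t c :: nat magma \<Rightarrow>\<^sub>0 'k"
    let ?n = "of_nat (card H) :: 'k"
    have M: "submodule free_operad 3 ?M"
      by (rule submodule_relations[OF subgroup_relations_arity[OF subset]])
    have gen: "?S (map_magma \<sigma> s) c - ?S (map_magma \<sigma> t) c \<in> ?M"
      if "monom s - monom t \<in> (subgroup_relations H :: (nat magma \<Rightarrow>\<^sub>0 'k) set)" "\<sigma> \<in> perms3" for s t \<sigma> c
    proof -
      have "relabel \<sigma> (Poly_Mapping.map ((*) c) (monom s - monom t)) \<in> ?M"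
        by (rule submoduleD(5)[OF M submoduleD(4)[OF M]], rule subsetD[OF relations_superset])
           (use that in auto)
      moreover have "Poly_Mapping.map ((*) c) (monom s - monom t) = ?S s c - ?S t c"
        by (rule poly_mapping_eqI) (simp add: monom_def lookup_minus lookup_single when_def right_diff_distrib)
      ultimately show ?thesis by (simp add: relabel_diff)
    qed
    have n0: "?n \<noteq> 0"
      using id_mem finite by (auto simp: card_eq_0_iff)
    have assoc: "?S (rtree \<sigma>) c - ?S (ltree \<sigma>) c \<in> ?M" if "\<sigma> \<in> perms3" for \<sigma> c
      using gen[OF _ that, of "rtree id" "ltree id" c] by (simp add: subgroup_relations_def)
    have perm: "?S (ltree \<sigma>) c - ?S (ltree (\<sigma> \<circ> h)) c \<in> ?M" if "\<sigma> \<in> perms3" "h \<in> H" for \<sigma> h c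
      using gen[OF _ that(1), of "ltree id" "ltree h" c] that(2) by (simp add: subgroup_relations_def)
    \<comment> \<open>the coset averages vanish: regroup by \<open>\<tau> = \<sigma> h\<close> and use that inversion permutes \<open>H\<close>\<close>
    have zero: "(\<Sum>\<sigma>\<in>perms3. \<Sum>h\<in>H. ?S (ltree (\<sigma> \<circ> h)) (?a \<sigma> / ?n)) = 0"
    proof -
      have "(\<Sum>\<sigma>\<in>perms3. ?S (ltree (\<sigma> \<circ> h)) (?a \<sigma> / ?n)) =
          (\<Sum>\<tau>\<in>perms3. ?S (ltree \<tau>) (?a (\<tau> \<circ> inv h) / ?n))" if "h \<in> H" for h
      proof -
        have h: "h permutes {1..3}" using that subset by blast
        show ?thesis
          by (rule sum.reindex_bij_witness[where i = "\<lambda>\<tau>. \<tau> \<circ> inv h" and j = "\<lambda>\<sigma>. \<sigma> \<circ> h"])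
             (simp_all only: mem_Collect_eq comp_assoc permutes_inv_o[OF h] comp_id
               permutes_compose[OF h] permutes_compose[OF permutes_inv[OF h]])
      qed
      then have "(\<Sum>\<sigma>\<in>perms3. \<Sum>h\<in>H. ?S (ltree (\<sigma> \<circ> h)) (?a \<sigma> / ?n)) =
          (\<Sum>h\<in>H. \<Sum>\<tau>\<in>perms3. ?S (ltree \<tau>) (?a (\<tau> \<circ> inv h) / ?n))"
        by (subst sum.swap) (rule sum.cong[OF refl])
      also have "\<dots> = (\<Sum>\<tau>\<in>perms3. \<Sum>h\<in>H. ?S (ltree \<tau>) (?a (\<tau> \<circ> inv h) / ?n))"
        by (rule sum.swap)
      also have "\<dots> = (\<Sum>\<tau>\<in>perms3. ?S (ltree \<tau>) ((\<Sum>h\<in>H. ?a (\<tau> \<circ> h)) / ?n))"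
        by (intro sum.cong refl poly_mapping_eqI)
           (simp add: lookup_sum lookup_single when_def sum_divide_distrib
             sum_inverse[of "\<lambda>h. ?a (_ \<circ> h) / ?n"])
      finally show ?thesis by (simp add: v0)
    qed
    have "v = (\<Sum>\<sigma>\<in>perms3. (?S (rtree \<sigma>) (?r \<sigma>) - ?S (ltree \<sigma>) (?r \<sigma>)) + ?S (ltree \<sigma>) (?a \<sigma>))"
      by (subst tree_expansion[OF v], rule sum.cong[OF refl], rule poly_mapping_eqI)
         (simp add: coeff_sum_def lookup_add lookup_minus lookup_single when_def)
    also have "\<dots> = (\<Sum>\<sigma>\<in>perms3. ?S (rtree \<sigma>) (?r \<sigma>) - ?S (ltree \<sigma>) (?r \<sigma>)) + (\<Sum>\<sigma>\<in>perms3. ?S (ltree \<sigma>) (?a \<sigma>))"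
      by (rule sum.distrib)
    also have "(\<Sum>\<sigma>\<in>perms3. ?S (ltree \<sigma>) (?a \<sigma>)) = (\<Sum>\<sigma>\<in>perms3. \<Sum>h\<in>H. ?S (ltree \<sigma>) (?a \<sigma> / ?n))"
      by (intro sum.cong refl poly_mapping_eqI) (use n0 in \<open>simp add: lookup_sum lookup_single when_def\<close>)
    also have "\<dots> = (\<Sum>\<sigma>\<in>perms3. \<Sum>h\<in>H. ?S (ltree \<sigma>) (?a \<sigma> / ?n) - ?S (ltree (\<sigma> \<circ> h)) (?a \<sigma> / ?n))"
      using zero by (simp add: sum_subtractf)
    finally show "v \<in> ?M"
      by (rule ssubst) (intro submoduleD(3)[OF M] submodule_sum[OF M] assoc perm)
  qed
qed

end

section \<open>The subgroups of the three operads\<close>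

lemma relations_eqI:
  assumes "G \<subseteq> arity free_operad 3" "G' \<subseteq> arity free_operad 3"
    and "G \<subseteq> relations G'" "G' \<subseteq> relations G"
  shows "relations G = relations G'"
  using assms relations_minimal[OF submodule_relations] by (intro equalityI) blast+

lemma perm_subgroup_involution:
  assumes "h permutes {1..3}" "h \<circ> h = id"
  shows "perm_subgroup {id, h}"
proof
  show "{id, h} \<subseteq> perms3"
    using assms permutes_id by auto
  show "inv g \<in> {id, h}" if "g \<in> {id, h}" for g
    using that assms(2) inv_unique_comp[of h h] by auto
qed (use assms in auto)

text \<open>
  The two 3-cycles, spelled out by their values so that they can be read off on the indices.
\<close>

definition rot :: "nat \<Rightarrow> nat"
  where "rot = id(1 := 2, 2 := 3, 3 := 1)"

definition rot' :: "nat \<Rightarrow> nat"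
  where "rot' = id(1 := 3, 2 := 1, 3 := 2)"

lemma rot_comp: "rot \<circ> rot = rot'" "rot \<circ> rot' = id" "rot' \<circ> rot = id" "rot' \<circ> rot' = rot"
  by (auto simp: rot_def rot'_def fun_eq_iff)

lemma rot_transpose:
  "rot = transpose 1 2 \<circ> transpose 2 3" "rot' = transpose 2 3 \<circ> transpose 1 2"
  by (auto simp: rot_def rot'_def fun_eq_iff transpose_def)

lemma rot_permutes: "rot permutes {1..3}" "rot' permutes {1..3}"
  unfolding rot_transpose by (intro permutes_compose permutes_swap_id; simp)+

lemma sign_rot: "sign rot = 1" "sign rot' = 1"
  unfolding rot_transpose by (simp_all add: sign_compose sign_swap_id permutation_swap_id)

lemma perm_subgroup_rot: "perm_subgroup {id, rot, rot'}"
proof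
  show "{id, rot, rot'} \<subseteq> perms3"
    using rot_permutes permutes_id by auto
  show "inv g \<in> {id, rot, rot'}" if "g \<in> {id, rot, rot'}" for g
    using that inv_unique_comp[of rot rot'] inv_unique_comp[of rot' rot] rot_comp by auto
qed (use rot_comp in auto)

lemma rot_neq: "rot \<noteq> id" "rot' \<noteq> id" "rot \<noteq> rot'"
proof -
  have "rot 1 = 2" "rot' 1 = 3" by (simp_all add: rot_def rot'_def)
  then show "rot \<noteq> id" "rot' \<noteq> id" "rot \<noteq> rot'" by (metis id_apply num.distinct numeral_eq_iff numeral_One)+
qed

lemma tree_monom:
  "monom (rtree \<sigma>) = rmon (\<sigma> 1) (\<sigma> 2) (\<sigma> 3)" "monom (ltree \<sigma>) = lmon (\<sigma> 1) (\<sigma> 2) (\<sigma> 3)"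
  by (simp_all add: rtree_def ltree_def rmon_def lmon_def)

lemma signed_associator_sum_monom:
  assumes "finite H"
  shows "signed_associator_sum H = (\<Sum>h\<in>H. Poly_Mapping.map ((*) (of_int (sign h)))
    (rmon (h 1) (h 2) (h 3) - lmon (h 1) (h 2) (h 3) :: nat magma \<Rightarrow>\<^sub>0 'k::field))"
  unfolding signed_associator_sum_def
proof (rule sum.cong[OF refl])
  fix h assume "h \<in> H"
  show "Poly_Mapping.single (rtree h) (of_int (sign h)) - Poly_Mapping.single (ltree h) (of_int (sign h)) =
    Poly_Mapping.map ((*) (of_int (sign h)))
      (rmon (h 1) (h 2) (h 3) - lmon (h 1) (h 2) (h 3) :: nat magma \<Rightarrow>\<^sub>0 'k)"
    unfolding tree_monom(1)[of h, symmetric] tree_monom(2)[of h, symmetric] monom_def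
    by (rule poly_mapping_eqI) (simp add: lookup_minus right_diff_distrib lookup_single when_def)
qed

lemma transpose_neq_id: "a \<noteq> b \<Longrightarrow> transpose a b \<noteq> id"
  by (metis id_apply transpose_apply_first)

lemma scale_one: "Poly_Mapping.map ((*) (1::'k::field)) f = f"
  and scale_minus_one: "Poly_Mapping.map ((*) (-1::'k::field)) f = - f"
  by (rule poly_mapping_eqI, simp)+

lemma Vinb_relations_eq:
  "Vinb_relations = relations {signed_associator_sum {id, transpose 1 2} :: nat magma \<Rightarrow>\<^sub>0 'k::field}"
proof -
  have "signed_associator_sum {id, transpose 1 2} =
      (rmon 1 2 3 - lmon 1 2 3 - rmon 2 1 3 + lmon 2 1 3 :: nat magma \<Rightarrow>\<^sub>0 'k)"
    by (simp add: signed_associator_sum_monom transpose_neq_id[symmetric] sign_swap_id scale_one scale_minus_one)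
  then show ?thesis by (simp only: Vinb_relations_def)
qed

lemma G4_Ass_relations_eq:
  "G4_Ass_relations = relations {signed_associator_sum {id, transpose 1 3} :: nat magma \<Rightarrow>\<^sub>0 'k::field}"
proof -
  have "signed_associator_sum {id, transpose 1 3} =
      (rmon 1 2 3 - lmon 1 2 3 - rmon 3 2 1 + lmon 3 2 1 :: nat magma \<Rightarrow>\<^sub>0 'k)"
    by (simp add: signed_associator_sum_monom transpose_neq_id[symmetric] sign_swap_id scale_one scale_minus_one)
  then show ?thesis by (simp only: G4_Ass_relations_def)
qed

lemma G5_Ass_relations_eq:
  "G5_Ass_relations = relations {signed_associator_sum {id, rot, rot'} :: nat magma \<Rightarrow>\<^sub>0 'k::field}"
proof -
  have "rot 1 = 2" "rot 2 = 3" "rot 3 = 1" "rot' 1 = 3" "rot' 2 = 1" "rot' 3 = 2"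
    by (simp_all add: rot_def rot'_def)
  then have "signed_associator_sum {id, rot, rot'} =
      (rmon 1 2 3 - lmon 1 2 3 + rmon 2 3 1 - lmon 2 3 1 + rmon 3 1 2 - lmon 3 1 2 :: nat magma \<Rightarrow>\<^sub>0 'k)"
    by (simp add: signed_associator_sum_monom rot_neq rot_neq[symmetric] sign_rot scale_one)
  then show ?thesis by (simp only: G5_Ass_relations_def)
qed

lemma mon_arity:
  assumes "distinct [i, j, k]" "{i, j, k} = {1..3}"
  shows "rmon i j k \<in> arity free_operad 3" "lmon i j k \<in> arity free_operad 3"
  using assms by (auto simp: rmon_def lmon_def monom_def monomials_def)

text \<open>
  The identity of \<open>H\<close> contributes the trivial relation to \<open>subgroup_relations H\<close>.
\<close>

lemma relations_insert_zero: "G \<subseteq> arity free_operad 3 \<Longrightarrow> relations (insert 0 G) = relations G"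
  using submoduleD(2)[OF submodule_relations] relations_superset[of G] relations_superset[of "insert 0 G"]
  by (intro relations_eqI) (auto simp del: free_operad_simps(1) simp: submoduleD(2)[OF submodule_arity])

lemma orth_Vinb:
  "orth Vinb_relations =
    relations {rmon 1 2 3 - lmon 1 2 3, lmon 1 2 3 - lmon 2 1 3 :: nat magma \<Rightarrow>\<^sub>0 'k::field_char_0}"
proof -
  interpret perm_subgroup "{id, transpose 1 2}"
    by (rule perm_subgroup_involution) (simp_all add: permutes_swap_id)
  let ?G = "{rmon 1 2 3 - lmon 1 2 3, lmon 1 2 3 - lmon 2 1 3 :: nat magma \<Rightarrow>\<^sub>0 'k}"
  have G: "subgroup_relations {id, transpose 1 2} = insert 0 ?G"
    by (auto simp: subgroup_relations_def tree_monom)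
  have "?G \<subseteq> arity free_operad 3"
    by (auto intro!: submodule_diff[OF submodule_arity] mon_arity simp del: free_operad_simps(1))
  then show ?thesis
    unfolding Vinb_relations_eq orth_eq G by (rule relations_insert_zero)
qed

lemma orth_G4:
  "orth G4_Ass_relations =
    relations {rmon 1 2 3 - lmon 1 2 3, lmon 1 2 3 - lmon 3 2 1 :: nat magma \<Rightarrow>\<^sub>0 'k::field_char_0}"
proof -
  interpret perm_subgroup "{id, transpose 1 3}"
    by (rule perm_subgroup_involution) (simp_all add: permutes_swap_id)
  let ?G = "{rmon 1 2 3 - lmon 1 2 3, lmon 1 2 3 - lmon 3 2 1 :: nat magma \<Rightarrow>\<^sub>0 'k}"
  have G: "subgroup_relations {id, transpose 1 3} = insert 0 ?G"
    by (auto simp: subgroup_relations_def tree_monom)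
  have "?G \<subseteq> arity free_operad 3"
    by (auto intro!: submodule_diff[OF submodule_arity] mon_arity simp del: free_operad_simps(1))
  then show ?thesis
    unfolding G4_Ass_relations_eq orth_eq G by (rule relations_insert_zero)
qed

text \<open>
  Invariance under both 3-cycles is equivalent to the chain of two equalities.
\<close>

lemma orth_G5:
  "orth G5_Ass_relations = relations {rmon 1 2 3 - lmon 1 2 3, lmon 1 2 3 - lmon 2 3 1,
    lmon 2 3 1 - lmon 3 1 2 :: nat magma \<Rightarrow>\<^sub>0 'k::field_char_0}" (is "_ = relations ?G")
proof -
  interpret perm_subgroup "{id, rot, rot'}" by (rule perm_subgroup_rot)
  have v: "rot 1 = 2" "rot 2 = 3" "rot 3 = 1" "rot' 1 = 3" "rot' 2 = 1" "rot' 3 = 2"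
    by (simp_all add: rot_def rot'_def)
  let ?K = "{rmon 1 2 3 - lmon 1 2 3, lmon 1 2 3 - lmon 2 3 1, lmon 1 2 3 - lmon 3 1 2 :: nat magma \<Rightarrow>\<^sub>0 'k}"
  have K: "subgroup_relations {id, rot, rot'} = insert 0 ?K"
    by (auto simp: subgroup_relations_def tree_monom v v[unfolded One_nat_def])
  have arK: "?K \<subseteq> arity free_operad 3" and arG: "?G \<subseteq> arity free_operad 3"
    by (auto intro!: submodule_diff[OF submodule_arity] mon_arity simp del: free_operad_simps(1))
  note D = submodule_diff[OF submodule_relations[OF arK]] and S = submoduleD(3)[OF submodule_relations[OF arG]]
  have "relations ?K = relations ?G"
  proof (rule relations_eqI[OF arK arG])
    have "(lmon 1 2 3 - lmon 2 3 1) + (lmon 2 3 1 - lmon 3 1 2) \<in> relations ?G"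
      by (rule S) (use relations_superset[of ?G] in auto)
    then show "?K \<subseteq> relations ?G" using relations_superset[of ?G] by simp
    have "(lmon 1 2 3 - lmon 3 1 2) - (lmon 1 2 3 - lmon 2 3 1) \<in> relations ?K"
      by (rule D) (use relations_superset[of ?K] in auto)
    then show "?G \<subseteq> relations ?K" using relations_superset[of ?K] by simp
  qed
  then show ?thesis
    unfolding G5_Ass_relations_eq orth_eq K relations_insert_zero[OF arK] .
qed

text \<open>
  Turns an identity between operations, whose arguments are sequences, into an identity in
  three elements.
\<close>

lemma arguments_of_three: "(\<forall>x. P (x (1::nat)) (x (2::nat)) (x (3::nat))) \<longleftrightarrow> (\<forall>a b c. P a b c)"
proof
  assume P: "\<forall>x. P (x (1::nat)) (x 2) (x 3)"
  show "\<forall>a b c. P a b c"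
  proof (intro allI)
    fix a b c show "P a b c"
      using P[rule_format, of "\<lambda>i. if i = 1 then a else if i = 2 then b else c"] by simp
  qed
qed blast

lemma operation_lmon_diff:
  assumes "vector_space scale"
  shows "(\<forall>x. operation scale \<mu> (rmon i j k - lmon l m n) x = 0) \<longleftrightarrow>
      (\<forall>x. \<mu> (\<mu> (x l) (x m)) (x n) = \<mu> (x i) (\<mu> (x j) (x k)))"
    and "(\<forall>x. operation scale \<mu> (lmon i j k - lmon l m n) x = 0) \<longleftrightarrow>
      (\<forall>x. \<mu> (\<mu> (x i) (x j)) (x k) = \<mu> (\<mu> (x l) (x m)) (x n))"
  by (auto simp: rmon_def lmon_def operation_diff[OF assms] operation_monom[OF assms])

lemma algebras_of_associative_quotient:
  fixes scale :: "'k::field \<Rightarrow> 'v::ab_group_add \<Rightarrow> 'v"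
  assumes vs: "vector_space scale"
    and G: "G \<subseteq> arity free_operad 3"
    and T: "\<And>\<mu>. (\<forall>g\<in>G. \<forall>x. operation scale \<mu> g x = 0) \<longleftrightarrow> associative_product \<mu> \<and> T \<mu>"
  shows "bij_betw (algebra_product (relations G))
    (algebra_structures (quadratic_operad (relations G)) scale)
    {\<mu>. bilinear_product scale \<mu> \<and> associative_product \<mu> \<and> T \<mu>}"
  using algebras_of_quadratic_operad[OF vs G] unfolding T .

theorem proposition2p2:
  fixes scale :: "'k::field_char_0 \<Rightarrow> 'v::ab_group_add \<Rightarrow> 'v"
  assumes "vector_space scale"
  shows
   "(dual_operad (Vinb_relations :: (nat magma \<Rightarrow>\<^sub>0 'k) set) =
       quadratic_operad (relations {rmon 1 2 3 - lmon 1 2 3, lmon 1 2 3 - lmon 2 1 3}) \<and>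
     bij_betw (algebra_product (orth Vinb_relations))
       (algebra_structures (dual_operad Vinb_relations) scale)
       {\<mu>. bilinear_product scale \<mu> \<and> associative_product \<mu> \<and>
            (\<forall>a b c. \<mu> (\<mu> a b) c = \<mu> (\<mu> b a) c)}) \<and>
    (dual_operad (G4_Ass_relations :: (nat magma \<Rightarrow>\<^sub>0 'k) set) =
       quadratic_operad (relations {rmon 1 2 3 - lmon 1 2 3, lmon 1 2 3 - lmon 3 2 1}) \<and>
     bij_betw (algebra_product (orth G4_Ass_relations))
       (algebra_structures (dual_operad G4_Ass_relations) scale)
       {\<mu>. bilinear_product scale \<mu> \<and> associative_product \<mu> \<and>
            (\<forall>a b c. \<mu> (\<mu> a b) c = \<mu> (\<mu> c b) a)}) \<and>
    (dual_operad (G5_Ass_relations :: (nat magma \<Rightarrow>\<^sub>0 'k) set) =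
       quadratic_operad (relations {rmon 1 2 3 - lmon 1 2 3, lmon 1 2 3 - lmon 2 3 1,
                                    lmon 2 3 1 - lmon 3 1 2}) \<and>
     bij_betw (algebra_product (orth G5_Ass_relations))
       (algebra_structures (dual_operad G5_Ass_relations) scale)
       {\<mu>. bilinear_product scale \<mu> \<and> associative_product \<mu> \<and>
            (\<forall>a b c. \<mu> (\<mu> a b) c = \<mu> (\<mu> b c) a \<and> \<mu> (\<mu> b c) a = \<mu> (\<mu> c a) b)})"
proof -
  note op = operation_lmon_diff[OF assms]
  have ass: "(\<forall>x. operation scale \<mu> (rmon 1 2 3 - lmon 1 2 3) x = 0) \<longleftrightarrow> associative_product \<mu>" for \<mu>
    unfolding op associative_product_def
    by (rule arguments_of_three[of "\<lambda>a b c. \<mu> (\<mu> a b) c = \<mu> a (\<mu> b c)"])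
  have swap12: "(\<forall>x. operation scale \<mu> (lmon 1 2 3 - lmon 2 1 3) x = 0) \<longleftrightarrow>
      (\<forall>a b c. \<mu> (\<mu> a b) c = \<mu> (\<mu> b a) c)" for \<mu>
    unfolding op by (rule arguments_of_three[of "\<lambda>a b c. \<mu> (\<mu> a b) c = \<mu> (\<mu> b a) c"])
  have swap13: "(\<forall>x. operation scale \<mu> (lmon 1 2 3 - lmon 3 2 1) x = 0) \<longleftrightarrow>
      (\<forall>a b c. \<mu> (\<mu> a b) c = \<mu> (\<mu> c b) a)" for \<mu>
    unfolding op by (rule arguments_of_three[of "\<lambda>a b c. \<mu> (\<mu> a b) c = \<mu> (\<mu> c b) a"])
  have cycle: "(\<forall>x. operation scale \<mu> (lmon 1 2 3 - lmon 2 3 1) x = 0) \<longleftrightarrow>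
      (\<forall>a b c. \<mu> (\<mu> a b) c = \<mu> (\<mu> b c) a)" for \<mu>
    unfolding op by (rule arguments_of_three[of "\<lambda>a b c. \<mu> (\<mu> a b) c = \<mu> (\<mu> b c) a"])
  have cycle': "(\<forall>x. operation scale \<mu> (lmon 2 3 1 - lmon 3 1 2) x = 0) \<longleftrightarrow>
      (\<forall>a b c. \<mu> (\<mu> b c) a = \<mu> (\<mu> c a) b)" for \<mu>
    unfolding op by (rule arguments_of_three[of "\<lambda>a b c. \<mu> (\<mu> b c) a = \<mu> (\<mu> c a) b"])
  have diff: "G \<subseteq> arity free_operad 3 \<Longrightarrow> s \<in> arity free_operad 3 \<Longrightarrow> t \<in> arity free_operad 3 \<Longrightarrow>
      insert (s - t) G \<subseteq> arity free_operad 3" for G and s t :: "nat magma \<Rightarrow>\<^sub>0 'k"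
    using submodule_diff[OF submodule_arity] by blast
  have mon: "(rmon 1 2 3 :: nat magma \<Rightarrow>\<^sub>0 'k) \<in> arity free_operad 3"
    "(lmon 1 2 3 :: nat magma \<Rightarrow>\<^sub>0 'k) \<in> arity free_operad 3"
    "(lmon 2 1 3 :: nat magma \<Rightarrow>\<^sub>0 'k) \<in> arity free_operad 3"
    "(lmon 3 2 1 :: nat magma \<Rightarrow>\<^sub>0 'k) \<in> arity free_operad 3"
    "(lmon 2 3 1 :: nat magma \<Rightarrow>\<^sub>0 'k) \<in> arity free_operad 3"
    "(lmon 3 1 2 :: nat magma \<Rightarrow>\<^sub>0 'k) \<in> arity free_operad 3"
    by (rule mon_arity; auto)+
  show ?thesis
    unfolding dual_operad_def orth_Vinb orth_G4 orth_G5
    by (intro conjI refl algebras_of_associative_quotient[OF assms] diff empty_subsetI mon)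
       (simp_all only: ball_simps simp_thms ass swap12 swap13 cycle cycle' all_conj_distrib)
qed

end
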